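(* If the min-variant of the matching problem for the subsequence relation, or the max-variant of the matching problem for the supersequence relation, can be solved in time $O(|w|+m)$, then one can decide whether a given dense graph $G$ (with $n$ vertices and $\Omega(n^2)$ edges) contains a triangle in time $O(|G|)$. This holds even if only the length of the answer string is required.
   Context: Input: a string $w\in\Sigma^*$ and an $\varepsilon$NFA $A=(Q,\Sigma,q_0,q_f,\delta)$, $\delta\subseteq Q\times(\Sigma\cup\{\varepsilon\})\times Q$, with $m=|\delta|$ transitions; $\mathcal{L}(A)$ is the set of strings labelling (ignoring $\varepsilon$) a path from $q_0$ to $q_f$. $u$ is a subsequence of $w$ if $u=w[j_1]\cdots w[j_{|u|}]$ for some $1\le j_1<\dots<j_{|u|}\le|w|$; $u$ is a supersequence of $w$ if $w$ is a subsequence of $u$. Min-variant of subsequence matching: compute a shortest subsequence of $w$ in $\mathcal{L}(A)$, or report none exists. Max-variant of supersequence matching: report that supersequences of $w$ in $\mathcal{L}(A)$ are unbounded in length, or compute a longest one, or report none exists. A triangle in an undirected graph is a set of three pairwise adjacent vertices; $|G|$ is the size of the graph. *)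

theory Defs
  imports Complex_Main "HOL-Library.Sublist" "HOL-Library.Landau_Symbols"
begin

section \<open>Model of computation\<close>

text \<open>
  Deterministic unit-cost word RAM: a program is a list of instructions with finitely many
  registers (those that it mentions) and an indirectly addressed memory. Registers and memory
  cells hold natural numbers. That machine words have only logarithmically many bits is imposed
  below, by requiring that every number occurring in a run is polynomially bounded in the size
  of the instance. The program halts when the program counter leaves the program.
\<close>

datatype binop = Plus | Minus | Times | Div | Mod | BitAnd | BitOr | BitXor | ShiftL | ShiftR

fun apply_binop :: "binop \<Rightarrow> nat \<Rightarrow> nat \<Rightarrow> nat" where
  "apply_binop Plus x y = x + y"
| "apply_binop Minus x y = x - y"
| "apply_binop Times x y = x * y"
| "apply_binop Div x y = x div y"
| "apply_binop Mod x y = x mod y"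
| "apply_binop BitAnd x y = Bit_Operations.and x y"
| "apply_binop BitOr x y = Bit_Operations.or x y"
| "apply_binop BitXor x y = Bit_Operations.xor x y"
| "apply_binop ShiftL x y = push_bit y x"
| "apply_binop ShiftR x y = drop_bit y x"

datatype instr =
    Const nat nat
  | Move nat nat
  | Binop binop nat nat nat
  | Load nat nat
  | Store nat nat
  | Jump nat
  | JumpEq nat nat nat
  | JumpLess nat nat nat

record config =
  pc :: nat
  regs :: "nat \<Rightarrow> nat"
  mem :: "nat \<Rightarrow> nat"

fun exec :: "instr \<Rightarrow> config \<Rightarrow> config" where
  "exec (Const r k) c = c\<lparr>pc := Suc (pc c), regs := (regs c)(r := k)\<rparr>"
| "exec (Move r s) c = c\<lparr>pc := Suc (pc c), regs := (regs c)(r := regs c s)\<rparr>"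
| "exec (Binop f r s t) c =
     c\<lparr>pc := Suc (pc c), regs := (regs c)(r := apply_binop f (regs c s) (regs c t))\<rparr>"
| "exec (Load r s) c = c\<lparr>pc := Suc (pc c), regs := (regs c)(r := mem c (regs c s))\<rparr>"
| "exec (Store r s) c = c\<lparr>pc := Suc (pc c), mem := (mem c)(regs c r := regs c s)\<rparr>"
| "exec (Jump l) c = c\<lparr>pc := l\<rparr>"
| "exec (JumpEq r s l) c = c\<lparr>pc := (if regs c r = regs c s then l else Suc (pc c))\<rparr>"
| "exec (JumpLess r s l) c = c\<lparr>pc := (if regs c r < regs c s then l else Suc (pc c))\<rparr>"

type_synonym prog = "instr list"

definition halted :: "prog \<Rightarrow> config \<Rightarrow> bool" where
  "halted P c \<longleftrightarrow> length P \<le> pc c"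

definition step :: "prog \<Rightarrow> config \<Rightarrow> config" where
  "step P c = (if halted P c then c else exec (P ! pc c) c)"

definition initial_config :: "nat list \<Rightarrow> config" where
  "initial_config ws =
     \<lparr>pc = 0, regs = (\<lambda>_. 0), mem = (\<lambda>a. if a < length ws then ws ! a else 0)\<rparr>"

definition config_at :: "prog \<Rightarrow> nat list \<Rightarrow> nat \<Rightarrow> config" where
  "config_at P ws t = (step P ^^ t) (initial_config ws)"

definition values_bounded :: "nat \<Rightarrow> config \<Rightarrow> bool" where
  "values_bounded B c \<longleftrightarrow> (\<forall>r. regs c r \<le> B) \<and> (\<forall>a. mem c a \<le> B)"

text \<open>
  A problem relates an instance to all of its admissible encodings (so an algorithm must work,
  for example, for every order in which a set is listed) and to the encodings of all of its
  correct answers. An answer is written to the first memory cells; what the other cells contain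
  at the end is irrelevant.
\<close>

record 'x problem =
  instances :: "'x set"
  inst_size :: "'x \<Rightarrow> nat"
  input_code :: "'x \<Rightarrow> nat list \<Rightarrow> bool"
  output_code :: "'x \<Rightarrow> nat list \<Rightarrow> bool"

text \<open>
  The number \<open>k\<close> is the constant factor in the word length \<open>k * log (N + 2)\<close>, for
  instances of size \<open>N\<close>.
\<close>

definition solves_within :: "prog \<Rightarrow> 'x problem \<Rightarrow> (nat \<Rightarrow> nat) \<Rightarrow> bool" where
  "solves_within P \<Pi> T \<longleftrightarrow>
     (\<exists>k. \<forall>x \<in> instances \<Pi>. \<forall>ws. input_code \<Pi> x ws \<longrightarrow>
        (\<exists>t \<le> T (inst_size \<Pi> x). \<exists>out.
           halted P (config_at P ws t) \<and>
           output_code \<Pi> x out \<and>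
           (\<forall>a < length out. mem (config_at P ws t) a = out ! a) \<and>
           (\<forall>s \<le> t. values_bounded ((inst_size \<Pi> x + 2) ^ k) (config_at P ws s))))"

definition solvable_in_time_O :: "'x problem \<Rightarrow> (nat \<Rightarrow> real) \<Rightarrow> bool" where
  "solvable_in_time_O \<Pi> f \<longleftrightarrow> (\<exists>P T. solves_within P \<Pi> T \<and> (\<lambda>N. real (T N)) \<in> O(f))"


section \<open>NFAs with \<open>\<epsilon>\<close>-transitions\<close>

text \<open>The label \<open>None\<close> stands for \<open>\<epsilon>\<close>.\<close>

record ('q, 'a) enfa =
  states :: "'q set"
  alphabet :: "'a set"
  init :: 'q
  final :: 'q
  trans :: "('q \<times> 'a option \<times> 'q) set"

definition is_enfa :: "('q, 'a) enfa \<Rightarrow> bool" where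
  "is_enfa A \<longleftrightarrow>
     finite (states A) \<and> finite (alphabet A) \<and> init A \<in> states A \<and> final A \<in> states A \<and>
     trans A \<subseteq> states A \<times> insert None (Some ` alphabet A) \<times> states A"

inductive path :: "('q \<times> 'a option \<times> 'q) set \<Rightarrow> 'q \<Rightarrow> 'a list \<Rightarrow> 'q \<Rightarrow> bool"
  for \<delta> where
  path_refl: "path \<delta> q [] q"
| path_eps: "(p, None, q) \<in> \<delta> \<Longrightarrow> path \<delta> q u r \<Longrightarrow> path \<delta> p u r"
| path_sym: "(p, Some a, q) \<in> \<delta> \<Longrightarrow> path \<delta> q u r \<Longrightarrow> path \<delta> p (a # u) r"

definition lang :: "('q, 'a) enfa \<Rightarrow> 'a list set" where
  "lang A = {u. path (trans A) (init A) u (final A)}"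


section \<open>The matching problems\<close>

datatype 'r answer = NoMatch | Unbounded | Match 'r

text \<open>In the library, \<open>subseq u w\<close> states that \<open>u\<close> is a (scattered) subsequence of \<open>w\<close>.\<close>

definition min_subseq_answer :: "'a list \<Rightarrow> ('q, 'a) enfa \<Rightarrow> 'a list answer \<Rightarrow> bool" where
  "min_subseq_answer w A ans =
     (case ans of
        NoMatch \<Rightarrow> \<not> (\<exists>u \<in> lang A. subseq u w)
      | Unbounded \<Rightarrow> False
      | Match u \<Rightarrow> is_arg_min length (\<lambda>v. v \<in> lang A \<and> subseq v w) u)"

definition max_superseq_answer :: "'a list \<Rightarrow> ('q, 'a) enfa \<Rightarrow> 'a list answer \<Rightarrow> bool" where
  "max_superseq_answer w A ans =
     (case ans of
        NoMatch \<Rightarrow> \<not> (\<exists>u \<in> lang A. subseq w u)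
      | Unbounded \<Rightarrow> (\<forall>l. \<exists>u \<in> lang A. subseq w u \<and> length u > l)
      | Match u \<Rightarrow> is_arg_max length (\<lambda>v. v \<in> lang A \<and> subseq w v) u)"

definition length_only ::
  "('a list \<Rightarrow> ('q, 'a) enfa \<Rightarrow> 'a list answer \<Rightarrow> bool) \<Rightarrow>
   'a list \<Rightarrow> ('q, 'a) enfa \<Rightarrow> nat answer \<Rightarrow> bool" where
  "length_only R w A l \<longleftrightarrow> (\<exists>ans. R w A ans \<and> l = map_answer length ans)"

type_synonym matching_input = "nat list \<times> (nat, nat) enfa"

text \<open>
  Integer alphabet: states and letters are numbered consecutively, and there are at most as many
  of them as can be relevant. A state other than the initial and the final one that is on no
  transition can be discarded, and so can a letter that occurs neither in \<open>w\<close> nor on a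
  transition.
\<close>

definition matching_inputs :: "matching_input set" where
  "matching_inputs =
     {(w, A). is_enfa A \<and> set w \<subseteq> alphabet A \<and>
        states A = {..<card (states A)} \<and> card (states A) \<le> 2 * card (trans A) + 2 \<and>
        alphabet A = {1..card (alphabet A)} \<and> card (alphabet A) \<le> length w + card (trans A)}"

fun label_code :: "nat option \<Rightarrow> nat" where
  "label_code None = 0"
| "label_code (Some a) = a"

definition matching_input_code :: "matching_input \<Rightarrow> nat list \<Rightarrow> bool" where
  "matching_input_code = (\<lambda>(w, A) ws.
     \<exists>ts. distinct ts \<and> set ts = trans A \<and>
       ws = [length w, card (alphabet A), card (states A), length ts, init A, final A] @ w @
            concat (map (\<lambda>(p, x, q). [p, label_code x, q]) ts))"

fun string_answer_code :: "nat list answer \<Rightarrow> nat list" where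
  "string_answer_code NoMatch = [0]"
| "string_answer_code (Match u) = [1, length u] @ u"
| "string_answer_code Unbounded = [2]"

fun length_answer_code :: "nat answer \<Rightarrow> nat list" where
  "length_answer_code NoMatch = [0]"
| "length_answer_code (Match l) = [1, l]"
| "length_answer_code Unbounded = [2]"

definition matching_problem ::
  "(nat list \<Rightarrow> (nat, nat) enfa \<Rightarrow> 'r answer \<Rightarrow> bool) \<Rightarrow> ('r answer \<Rightarrow> nat list) \<Rightarrow>
   matching_input problem" where
  "matching_problem R code =
     \<lparr>instances = matching_inputs,
      inst_size = (\<lambda>(w, A). length w + card (trans A)),
      input_code = matching_input_code,
      output_code = (\<lambda>(w, A) out. \<exists>ans. R w A ans \<and> out = code ans)\<rparr>"

definition min_subseq_problem :: "matching_input problem" where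
  "min_subseq_problem = matching_problem min_subseq_answer string_answer_code"

definition max_superseq_problem :: "matching_input problem" where
  "max_superseq_problem = matching_problem max_superseq_answer string_answer_code"

definition min_subseq_length_problem :: "matching_input problem" where
  "min_subseq_length_problem = matching_problem (length_only min_subseq_answer) length_answer_code"

definition max_superseq_length_problem :: "matching_input problem" where
  "max_superseq_length_problem =
     matching_problem (length_only max_superseq_answer) length_answer_code"


section \<open>Triangle detection in dense graphs\<close>

text \<open>A graph \<open>(n, E)\<close> has the vertices \<open>0, \<dots>, n - 1\<close> and the set \<open>E\<close> of edges.\<close>

type_synonym graph = "nat \<times> nat set set"

definition is_graph :: "graph \<Rightarrow> bool" where
  "is_graph = (\<lambda>(n, E). E \<subseteq> {{u, v} | u v. u < n \<and> v < n \<and> u \<noteq> v})"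

definition has_triangle :: "graph \<Rightarrow> bool" where
  "has_triangle = (\<lambda>(n, E).
     \<exists>S \<subseteq> {..<n}. card S = 3 \<and> (\<forall>u \<in> S. \<forall>v \<in> S. u \<noteq> v \<longrightarrow> {u, v} \<in> E))"

definition edge_list_code :: "graph \<Rightarrow> nat list \<Rightarrow> bool" where
  "edge_list_code = (\<lambda>(n, E) ws.
     \<exists>es. distinct (map (\<lambda>(u, v). {u, v}) es) \<and> set (map (\<lambda>(u, v). {u, v}) es) = E \<and>
       ws = [n, length es] @ concat (map (\<lambda>(u, v). [u, v]) es))"

definition dense_triangle_problem :: "real \<Rightarrow> graph problem" where
  "dense_triangle_problem c =
     \<lparr>instances = {(n, E). is_graph (n, E) \<and> c * real n ^ 2 \<le> real (card E)},
      inst_size = (\<lambda>(n, E). n + card E),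
      input_code = edge_list_code,
      output_code = (\<lambda>G out. out = [if has_triangle G then 1 else 0])\<rparr>"

end

theory Submission
  imports Defs "HOL-Library.More_List"
begin

text \<open>
  A triangle is a closed walk of length 3. From a graph with vertices \<open>0, \<dots>, n - 1\<close> one builds an
  automaton that guesses vertices \<open>u < v < x\<close> and \<open>u' < x\<close> with edges \<open>uv\<close>, \<open>vx\<close>, \<open>u'x\<close> and reads
  \<open>b^(2(n-u)) a^(n+u-u') b^(2u')\<close>; the only other string that it accepts is \<open>b^(4n)\<close>. The string
  for \<open>u, u'\<close> has length \<open>3n + u' - u\<close>. It is a subsequence of \<open>b^(2n) a^n b^(2n)\<close> iff \<open>u \<le> u'\<close>,
  and a supersequence of \<open>a^n\<close> iff \<open>u' \<le> u\<close>. So in both problems the optimum is \<open>3n\<close> iff some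
  closed walk \<open>u = u'\<close> exists. The automaton has \<open>O(n^2 + |E|)\<close> transitions, because the letters
  \<open>a\<close> are read on a separate line of states for each vertex; this is linear for dense graphs.

  On the word RAM, the encoded matching instance is written over the graph, the given program is
  run on it with its registers renamed and its jumps relocated, and the two answer cells are
  compared with \<open>1\<close> and \<open>3n\<close>.
\<close>

text \<open>Comparing \<open>u\<close> with \<open>u'\<close> inside the automaton, say by a copy of
  the walk for every start \<open>u\<close>, would take on the order of \<open>n * |E|\<close>
  transitions. Here the optimum makes the comparison, and one copy of the middle vertices serves all
  starts. The invariant behind it: in every accepted string, \<open>b^(4n)\<close> included, the
  length plus the number of letters \<open>a\<close> is \<open>4n\<close>. This is why the letters
  \<open>b\<close> come in pairs; with single ones all walk strings would have length
  \<open>2n\<close>. A bound on the number of \<open>a\<close> therefore bounds the length from the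
  other side: at most \<open>n\<close> of them force length at least \<open>3n\<close>, at least
  \<open>n\<close> of them force length at most \<open>3n\<close>. The optimization pushes against
  exactly this bound, and a walk string has \<open>n\<close> letters \<open>a\<close> only for
  \<open>u = u'\<close>. The string \<open>b^(4n)\<close> is read when the chain is never left. For
  \<open>n > 0\<close> it is harmless: too long to be a minimum of \<open>3n\<close>, and without
  the letters \<open>a\<close> that a supersequence must contain.\<close>

section \<open>Total correctness of RAM code\<close>

text \<open>The bound is demanded at every intermediate step, since the word length restricts the
  whole run.\<close>

definition runs :: "prog \<Rightarrow> nat \<Rightarrow> config \<Rightarrow> nat \<Rightarrow> config \<Rightarrow> bool" where
  "runs P B c t c' \<longleftrightarrow>
     (step P ^^ t) c = c' \<and> (\<forall>s \<le> t. values_bounded B ((step P ^^ s) c))"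

lemma runs_refl: "values_bounded B c \<Longrightarrow> runs P B c 0 c"
  by (simp add: runs_def)

lemma runs_single: "step P c = c' \<Longrightarrow> values_bounded B c \<Longrightarrow> values_bounded B c' \<Longrightarrow> runs P B c 1 c'"
  by (auto simp: runs_def le_Suc_eq)

lemma runs_trans:
  assumes "runs P B c t c'" "runs P B c' t' c''"
  shows "runs P B c (t + t') c''"
proof -
  have "values_bounded B ((step P ^^ s) c)" if "s \<le> t + t'" for s
  proof (cases "s \<le> t")
    case True
    then show ?thesis using assms by (simp add: runs_def)
  next
    case False
    then obtain d where d: "s = d + t" using le_Suc_ex[of t s] by (auto simp: add.commute)
    with that have "d \<le> t'" by simp
    then show ?thesis using assms unfolding d by (simp add: runs_def funpow_add)
  qed
  moreover have "(step P ^^ (t + t')) c = c''"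
    using assms by (simp add: runs_def add.commute[of t] funpow_add)
  ultimately show ?thesis by (simp add: runs_def)
qed

lemma runs_bounded: "runs P B c t c' \<Longrightarrow> values_bounded B c \<and> values_bounded B c'"
  by (auto simp: runs_def)

definition code_at :: "prog \<Rightarrow> nat \<Rightarrow> instr list \<Rightarrow> bool" where
  "code_at P off xs \<longleftrightarrow> (\<forall>i < length xs. off + i < length P \<and> P ! (off + i) = xs ! i)"

lemma code_at_Nil [simp]: "code_at P off []"
  by (simp add: code_at_def)

lemma code_at_Cons [simp]:
  "code_at P off (x # xs) \<longleftrightarrow> off < length P \<and> P ! off = x \<and> code_at P (Suc off) xs"
proof -
  have "code_at P off (x # xs) \<longleftrightarrow>
      (\<forall>i < Suc (length xs). off + i < length P \<and> P ! (off + i) = (x # xs) ! i)"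
    by (simp add: code_at_def)
  also have "\<dots> \<longleftrightarrow> off < length P \<and> P ! off = x \<and> code_at P (Suc off) xs"
    by (simp add: code_at_def All_less_Suc2)
  finally show ?thesis .
qed

lemma code_at_append [simp]:
  "code_at P off (xs @ ys) \<longleftrightarrow> code_at P off xs \<and> code_at P (off + length xs) ys"
proof (induction xs arbitrary: off)
  case (Cons x xs)
  show ?case by (simp add: Cons.IH)
qed simp

abbreviation cfg :: "nat \<Rightarrow> (nat \<Rightarrow> nat) \<Rightarrow> (nat \<Rightarrow> nat) \<Rightarrow> config" where
  "cfg p R M \<equiv> \<lparr>pc = p, regs = R, mem = M\<rparr>"

lemma ex_runsI:
  assumes "runs P B c t (cfg p R M)" "Q R M" "t \<le> T"
  shows "\<exists>t \<le> T. \<exists>R M. runs P B c t (cfg p R M) \<and> Q R M"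
  using assms by blast

type_synonym assn = "(nat \<Rightarrow> nat) \<Rightarrow> (nat \<Rightarrow> nat) \<Rightarrow> bool"

text \<open>Code is a function of the address at which it is placed, since jump targets are absolute.\<close>

type_synonym code = "nat \<Rightarrow> instr list"

text \<open>The program counter does not occur in assertions: code is entered at its first address
  and left just behind its last, inside an arbitrary program \<open>P\<close>. As \<open>T\<close>
  is only an upper bound, branches of different cost fit one triple.\<close>

definition triple :: "nat \<Rightarrow> assn \<Rightarrow> code \<Rightarrow> nat \<Rightarrow> assn \<Rightarrow> bool" where
  "triple B Pre C T Post \<longleftrightarrow>
     (\<forall>P off R M. code_at P off (C off) \<longrightarrow> Pre R M \<longrightarrow> values_bounded B (cfg off R M) \<longrightarrow>
        (\<exists>t \<le> T. \<exists>R' M'. runs P B (cfg off R M) t (cfg (off + length (C off)) R' M') \<and> Post R' M'))"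

lemma tripleI:
  assumes "\<And>P off R M. \<lbrakk>code_at P off (C off); Pre R M; values_bounded B (cfg off R M)\<rbrakk> \<Longrightarrow>
     \<exists>t \<le> T. \<exists>R' M'. runs P B (cfg off R M) t (cfg (off + length (C off)) R' M') \<and> Post R' M'"
  shows "triple B Pre C T Post"
  using assms unfolding triple_def by blast

lemma tripleE:
  assumes "triple B Pre C T Post" "code_at P off (C off)" "Pre R M" "values_bounded B (cfg off R M)"
  obtains t R' M' where "t \<le> T" "runs P B (cfg off R M) t (cfg (off + length (C off)) R' M')"
    "Post R' M'" "values_bounded B (cfg (off + length (C off)) R' M')"
  using assms runs_bounded unfolding triple_def by metis

lemma triple_weaken:
  assumes "triple B Pre C T Post"
    and "\<And>R M. Pre' R M \<Longrightarrow> Pre R M" "T \<le> T'" "\<And>R M. Post R M \<Longrightarrow> Post' R M"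
  shows "triple B Pre' C T' Post'"
  using assms unfolding triple_def by (meson order_trans)

section \<open>Rules for sequences, straight-line code, loops and tests\<close>

definition seqc :: "code \<Rightarrow> code \<Rightarrow> code" (infixr ";;" 60) where
  "(C ;; D) = (\<lambda>off. C off @ D (off + length (C off)))"

lemma triple_seq:
  assumes C: "triple B Pre C T1 Mid" and D: "triple B Mid D T2 Post"
  shows "triple B Pre (C ;; D) (T1 + T2) Post"
proof (rule tripleI)
  fix P off R M
  assume 1: "code_at P off ((C ;; D) off)" "Pre R M" "values_bounded B (cfg off R M)"
  then have c: "code_at P off (C off)"
      "code_at P (off + length (C off)) (D (off + length (C off)))"
    by (simp_all add: seqc_def)
  obtain t1 R1 M1 where a: "t1 \<le> T1"
      "runs P B (cfg off R M) t1 (cfg (off + length (C off)) R1 M1)" "Mid R1 M1"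
      "values_bounded B (cfg (off + length (C off)) R1 M1)"
    using tripleE[OF C c(1) 1(2,3)] .
  obtain t2 R2 M2 where b: "t2 \<le> T2"
      "runs P B (cfg (off + length (C off)) R1 M1) t2
         (cfg (off + length (C off) + length (D (off + length (C off)))) R2 M2)" "Post R2 M2"
    using tripleE[OF D c(2) a(3,4)] .
  show "\<exists>t \<le> T1 + T2. \<exists>R' M'.
      runs P B (cfg off R M) t (cfg (off + length ((C ;; D) off)) R' M') \<and> Post R' M'"
    using runs_trans[OF a(2) b(2)] a(1) b(1,3)
    by (intro ex_runsI[where t = "t1 + t2"]) (simp_all add: seqc_def add.assoc)
qed

text \<open>Only literals and computed values need a bound; moved, loaded and stored values come
  from a configuration that already obeys it. Jumps get \<open>False\<close>, as this calculus is
  for straight-line code.\<close>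

fun wpi :: "nat \<Rightarrow> instr \<Rightarrow> assn \<Rightarrow> assn" where
  "wpi B (Const r k) Q R M = (k \<le> B \<and> Q (R(r := k)) M)"
| "wpi B (Move r s) Q R M = Q (R(r := R s)) M"
| "wpi B (Binop f r s t) Q R M =
     (apply_binop f (R s) (R t) \<le> B \<and> Q (R(r := apply_binop f (R s) (R t))) M)"
| "wpi B (Load r s) Q R M = Q (R(r := M (R s))) M"
| "wpi B (Store r s) Q R M = Q R (M(R r := R s))"
| "wpi B _ Q R M = False"

fun wps :: "nat \<Rightarrow> instr list \<Rightarrow> assn \<Rightarrow> assn" where
  "wps B [] Q = Q"
| "wps B (i # is) Q = wpi B i (wps B is Q)"

lemma step_at: "off < length P \<Longrightarrow> step P (cfg off R M) = exec (P ! off) (cfg off R M)"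
  by (simp add: step_def halted_def)

lemma wpi_step:
  assumes "wpi B i Q R M" "values_bounded B (cfg off R M)" "off < length P" "P ! off = i"
  shows "\<exists>R' M'. runs P B (cfg off R M) 1 (cfg (Suc off) R' M') \<and> Q R' M'"
proof -
  obtain R' M' where "exec i (cfg off R M) = cfg (Suc off) R' M'" "Q R' M'"
     "values_bounded B (cfg (Suc off) R' M')"
    using assms(1,2) by (cases i) (auto simp: values_bounded_def)
  then show ?thesis using assms runs_single[of P "cfg off R M"] step_at by metis
qed

lemma wps_runs:
  assumes "wps B is Q R M" "values_bounded B (cfg off R M)" "code_at P off is"
  shows "\<exists>R' M'. runs P B (cfg off R M) (length is) (cfg (off + length is) R' M') \<and> Q R' M'"
  using assms
proof (induction "is" arbitrary: off R M)
  case Nil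
  then show ?case using runs_refl[OF Nil(2)] by (intro exI[of _ R] exI[of _ M]) simp
next
  case (Cons i "is")
  obtain R1 M1 where 1: "runs P B (cfg off R M) 1 (cfg (Suc off) R1 M1)" "wps B is Q R1 M1"
    using wpi_step[of B i "wps B is Q" R M off P] Cons.prems by auto
  then obtain R2 M2 where "runs P B (cfg (Suc off) R1 M1) (length is)
      (cfg (Suc off + length is) R2 M2)" "Q R2 M2"
    using Cons.IH[of R1 M1 "Suc off"] Cons.prems runs_bounded by auto
  then show ?case using runs_trans[OF 1(1)] by fastforce
qed

lemma triple_wps:
  assumes "\<And>R M. Pre R M \<Longrightarrow> wps B is Q R M" "length is \<le> T"
  shows "triple B Pre (\<lambda>_. is) T Q"
  using assms wps_runs by (intro tripleI) blast

text \<open>A successful test jumps over the exit jump. So each round costs its body plus 2 (test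
  and jump back), and leaving the loop costs 2 (failed test and exit jump).\<close>

definition whilec :: "nat \<Rightarrow> nat \<Rightarrow> code \<Rightarrow> code" where
  "whilec r s C = (\<lambda>off.
     [JumpLess r s (off + 2), Jump (off + 3 + length (C (off + 2)))] @ C (off + 2) @ [Jump off])"

lemma triple_while:
  assumes body: "\<And>i. i < k \<Longrightarrow> triple B (I i) C T (I (Suc i))"
    and guard: "\<And>i R M. i \<le> k \<Longrightarrow> I i R M \<Longrightarrow> R r < R s \<longleftrightarrow> i < k"
  shows "triple B (I 0) (whilec r s C) (k * (T + 2) + 2) (I k)"
proof (rule tripleI)
  fix P off R M
  assume code: "code_at P off (whilec r s C off)"
    and init: "I 0 R M" "values_bounded B (cfg off R M)"
  define off' where "off' = off + 2"
  have C: "code_at P off' (C off')"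
    and l: "off < length P" "Suc off < length P" "off' + length (C off') < length P"
    and i: "P ! off = JumpLess r s off'" "P ! Suc off = Jump (off' + length (C off') + 1)"
      "P ! (off' + length (C off')) = Jump off"
    using code by (auto simp: whilec_def off'_def add.commute)
  \<comment> \<open>Induction on the number \<open>d\<close> of rounds still to come.\<close>
  have "\<exists>t \<le> d * (T + 2) + 2. \<exists>R' M'.
      runs P B (cfg off R M) t (cfg (off' + length (C off') + 1) R' M') \<and> I k R' M'"
    if "I (k - d) R M" "values_bounded B (cfg off R M)" "d \<le> k" for d R M
    using that
  proof (induction d arbitrary: R M)
    case 0
    then have g: "\<not> R r < R s" using guard[of k R M] by simp
    have 1: "runs P B (cfg off R M) 1 (cfg (Suc off) R M)"
      using g 0 l i by (intro runs_single) (auto simp: step_at values_bounded_def)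
    have 2: "runs P B (cfg (Suc off) R M) 1 (cfg (off' + length (C off') + 1) R M)"
      using g 0 l i by (intro runs_single) (auto simp: step_at values_bounded_def)
    show ?case using 0(1) by (intro ex_runsI[OF runs_trans[OF 1 2]]) simp_all
  next
    case (Suc d)
    have g: "R r < R s" using guard[of "k - Suc d" R M] Suc.prems by simp
    have 1: "runs P B (cfg off R M) 1 (cfg off' R M)"
      using g Suc.prems l i by (intro runs_single) (auto simp: step_at values_bounded_def)
    have lt: "k - Suc d < k" using Suc.prems(3) by simp
    obtain t R1 M1 where 2: "t \<le> T" "runs P B (cfg off' R M) t (cfg (off' + length (C off')) R1 M1)"
        "I (Suc (k - Suc d)) R1 M1"
        "values_bounded B (cfg (off' + length (C off')) R1 M1)"
      using tripleE[OF body[OF lt] C Suc.prems(1) conjunct2[OF runs_bounded[OF 1]]] .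
    have 3: "runs P B (cfg (off' + length (C off')) R1 M1) 1 (cfg off R1 M1)"
      using runs_bounded[OF 2(2)] l i
      by (intro runs_single) (auto simp: step_at values_bounded_def)
    have "I (k - d) R1 M1" using 2(3) Suc.prems(3) by (simp add: Suc_diff_Suc)
    with Suc.IH[of R1 M1] runs_bounded[OF 3] Suc.prems obtain t' R2 M2
      where 4: "t' \<le> d * (T + 2) + 2"
        "runs P B (cfg off R1 M1) t' (cfg (off' + length (C off') + 1) R2 M2)" "I k R2 M2"
      by auto
    have "1 + t + 1 + t' \<le> Suc d * (T + 2) + 2" using 2(1) 4(1) by (simp add: algebra_simps)
    then show ?case
      using ex_runsI[where Q = "I k",
          OF runs_trans[OF runs_trans[OF runs_trans[OF 1 2(2)] 3] 4(2)] 4(3)]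
      by blast
  qed
  from this[of k R M] init
  show "\<exists>t \<le> k * (T + 2) + 2. \<exists>R' M'.
      runs P B (cfg off R M) t (cfg (off + length (whilec r s C off)) R' M') \<and> I k R' M'"
    by (simp add: whilec_def off'_def add.commute)
qed

definition unless_eqc :: "nat \<Rightarrow> nat \<Rightarrow> code \<Rightarrow> code" where
  "unless_eqc r s C = (\<lambda>off. JumpEq r s (off + 1 + length (C (off + 1))) # C (off + 1))"

lemma triple_unless_eq:
  assumes neq: "triple B (\<lambda>R M. Pre R M \<and> R r \<noteq> R s) C T Post"
    and eq: "\<And>R M. Pre R M \<Longrightarrow> R r = R s \<Longrightarrow> Post R M"
  shows "triple B Pre (unless_eqc r s C) (T + 1) Post"
proof (rule tripleI)
  fix P off R M
  assume code: "code_at P off (unless_eqc r s C off)"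
    and init: "Pre R M" "values_bounded B (cfg off R M)"
  have code': "off < length P" "P ! off = JumpEq r s (off + 1 + length (C (off + 1)))"
    "code_at P (off + 1) (C (off + 1))"
    using code by (auto simp: unless_eqc_def)
  show "\<exists>t \<le> T + 1. \<exists>R' M'.
     runs P B (cfg off R M) t (cfg (off + length (unless_eqc r s C off)) R' M') \<and> Post R' M'"
  proof (cases "R r = R s")
    case True
    then have "runs P B (cfg off R M) 1 (cfg (off + 1 + length (C (off + 1))) R M)"
      using init code' by (intro runs_single) (auto simp: step_at values_bounded_def)
    then show ?thesis using True init eq[of R M]
      by (intro ex_runsI[where t = 1]) (simp_all add: unless_eqc_def)
  next
    case False
    have 1: "runs P B (cfg off R M) 1 (cfg (off + 1) R M)"
      using False init code' by (intro runs_single) (auto simp: step_at values_bounded_def)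
    obtain t R1 M1 where 2: "t \<le> T"
        "runs P B (cfg (off + 1) R M) t (cfg (off + 1 + length (C (off + 1))) R1 M1)" "Post R1 M1"
        "values_bounded B (cfg (off + 1 + length (C (off + 1))) R1 M1)"
      using tripleE[OF neq code'(3) conjI[OF init(1) False] conjunct2[OF runs_bounded[OF 1]]] .
    then show ?thesis using runs_trans[OF 1 2(2)]
      by (intro ex_runsI[where t = "1 + t"]) (simp_all add: unless_eqc_def)
  qed
qed

section \<open>Relocating a program\<close>

text \<open>
  Register numbers are shifted by \<open>d\<close>, so that the registers below \<open>d\<close> survive the run. A jump
  out of the program, to whatever address, becomes a jump to the instruction just behind it.
\<close>

fun reloc :: "nat \<Rightarrow> nat \<Rightarrow> nat \<Rightarrow> instr \<Rightarrow> instr" where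
  "reloc d off n (Const r k) = Const (r + d) k"
| "reloc d off n (Move r s) = Move (r + d) (s + d)"
| "reloc d off n (Binop f r s t) = Binop f (r + d) (s + d) (t + d)"
| "reloc d off n (Load r s) = Load (r + d) (s + d)"
| "reloc d off n (Store r s) = Store (r + d) (s + d)"
| "reloc d off n (Jump l) = Jump (off + min l n)"
| "reloc d off n (JumpEq r s l) = JumpEq (r + d) (s + d) (off + min l n)"
| "reloc d off n (JumpLess r s l) = JumpLess (r + d) (s + d) (off + min l n)"

definition relocc :: "nat \<Rightarrow> prog \<Rightarrow> code" where
  "relocc d P = (\<lambda>off. map (reloc d off (length P)) P)"

definition overlay :: "nat \<Rightarrow> (nat \<Rightarrow> nat) \<Rightarrow> (nat \<Rightarrow> nat) \<Rightarrow> nat \<Rightarrow> nat" where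
  "overlay d R0 R = (\<lambda>r. if r < d then R0 r else R (r - d))"

lemma overlay_add [simp]: "overlay d R0 R (r + d) = R r"
  by (simp add: overlay_def)

lemma overlay_upd: "(overlay d R0 R)(r + d := x) = overlay d R0 (R(r := x))"
  by (auto simp: overlay_def fun_eq_iff)

definition shifted :: "nat \<Rightarrow> (nat \<Rightarrow> nat) \<Rightarrow> nat \<Rightarrow> nat \<Rightarrow> config \<Rightarrow> config" where
  "shifted d R0 off n c = cfg (off + min (pc c) n) (overlay d R0 (regs c)) (mem c)"

text \<open>The lockstep ends when \<open>P\<close> halts: from there on \<open>P\<close> stays put,
  whereas \<open>Q\<close> continues with the code behind the copy.\<close>

lemma reloc_step:
  assumes "code_at Q off (relocc d P off)" "\<not> halted P c"
  shows "step Q (shifted d R0 off (length P) c) = shifted d R0 off (length P) (step P c)"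
proof -
  have pc: "pc c < length P" using assms(2) by (simp add: halted_def)
  then have "off + pc c < length Q" "Q ! (off + pc c) = reloc d off (length P) (P ! pc c)"
    using assms(1) by (auto simp: code_at_def relocc_def)
  then show ?thesis using pc
    by (cases "P ! pc c")
       (auto simp: step_def halted_def shifted_def overlay_upd min_def)
qed

lemma halted_stable: "halted P c \<Longrightarrow> (step P ^^ t) c = c"
  by (induction t) (auto simp: step_def)

lemma triple_reloc:
  assumes halt: "halted P (config_at P ws t)"
    and bnd: "\<And>s. s \<le> t \<Longrightarrow> values_bounded B (config_at P ws s)"
  shows "triple B
     (\<lambda>R M. (\<forall>r \<ge> d. R r = 0) \<and> (\<forall>r < d. R r = R0 r) \<and> M = mem (initial_config ws))
     (relocc d P) t
     (\<lambda>R M. (\<forall>r < d. R r = R0 r) \<and> M = mem (config_at P ws t))"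
proof (rule tripleI, elim conjE)
  fix Q off R M
  assume code: "code_at Q off (relocc d P off)" and vb: "values_bounded B (cfg off R M)"
    and R: "\<forall>r \<ge> d. R r = 0" "\<forall>r < d. R r = R0 r" and M: "M = mem (initial_config ws)"
  let ?sh = "shifted d R0 off (length P)"
  \<comment> \<open>\<open>t\<close> may lie beyond the first halt, when the copy would already have
    been left. Between \<open>t0\<close> and \<open>t\<close> the configuration of \<open>P\<close>
    does not change.\<close>
  define t0 where "t0 = (LEAST t. halted P (config_at P ws t))"
  have t0: "halted P (config_at P ws t0)" "t0 \<le> t"
    unfolding t0_def using halt by (auto intro: LeastI Least_le)
  have nh: "\<not> halted P (config_at P ws s)" if "s < t0" for s
    using that not_less_Least unfolding t0_def by blast
  have c0: "cfg off R M = ?sh (initial_config ws)"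
    using R M by (auto simp: shifted_def initial_config_def overlay_def fun_eq_iff)
  have run: "(step Q ^^ s) (cfg off R M) = ?sh (config_at P ws s)" if "s \<le> t0" for s
    using that
  proof (induction s)
    case 0
    then show ?case by (simp add: c0 config_at_def)
  next
    case (Suc s)
    then show ?case using reloc_step[OF code nh[of s]] by (simp add: config_at_def)
  qed
  have "values_bounded B (?sh (config_at P ws s))" if "s \<le> t0" for s
  proof -
    have "R0 r \<le> B" if "r < d" for r
      using vb R(2) that by (metis config.select_convs(2) values_bounded_def)
    then show ?thesis
      using bnd[of s] that t0(2) by (simp add: values_bounded_def shifted_def overlay_def)
  qed
  then have "runs Q B (cfg off R M) t0 (?sh (config_at P ws t0))"
    using run by (simp add: runs_def)
  moreover have "config_at P ws t = config_at P ws t0"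
    using halted_stable[OF t0(1), of "t - t0"] t0(2)
    by (simp add: config_at_def flip: funpow_add[THEN fun_cong, unfolded comp_apply])
  moreover have "?sh (config_at P ws t0) =
      cfg (off + length (relocc d P off)) (overlay d R0 (regs (config_at P ws t0)))
        (mem (config_at P ws t0))"
    using t0(1) by (simp add: shifted_def halted_def min_def relocc_def)
  ultimately show "\<exists>t' \<le> t. \<exists>R' M'.
      runs Q B (cfg off R M) t' (cfg (off + length (relocc d P off)) R' M') \<and>
      (\<forall>r < d. R' r = R0 r) \<and> M' = mem (config_at P ws t)"
    using t0(2) by (intro ex_runsI[where t = t0 and M = "mem (config_at P ws t0)"
      and R = "overlay d R0 (regs (config_at P ws t0))"]) (simp_all add: overlay_def)
qed

section \<open>The walk automaton\<close>

text \<open>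
  \<open>C 0, \<dots>, C (4 * n)\<close> is the chain of letters \<open>b\<close> (coded by 2). The line of vertex \<open>u\<close> consists of
  two runs of \<open>n\<close> letters \<open>a\<close> (coded by 1): \<open>L u 0, \<dots>, L u n\<close>, whose end starts a walk at \<open>u\<close>, and
  \<open>L u (n + 1), \<dots>, L u (2 * n + 1)\<close>, whose beginning ends a walk at \<open>u\<close>. The chain is left and
  rejoined by \<open>\<epsilon>\<close>-transitions in the middle of the lines, at points that depend on \<open>u\<close>.
  \<open>V1\<close> and \<open>V2\<close> are the second and third vertex of the walk.
\<close>

datatype st = C nat | V1 nat | V2 nat | L nat nat

text \<open>Neighbours on the chain and on each line get consecutive numbers, so that a loop with a
  single counter can write a run of transitions.\<close>

fun enc :: "nat \<Rightarrow> st \<Rightarrow> nat" where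
  "enc n (C j) = j"
| "enc n (V1 v) = 4 * n + 1 + v"
| "enc n (V2 v) = 5 * n + 1 + v"
| "enc n (L u k) = 6 * n + 1 + u * (2 * n + 2) + k"

fun valid :: "nat \<Rightarrow> st \<Rightarrow> bool" where
  "valid n (C j) \<longleftrightarrow> j \<le> 4 * n"
| "valid n (V1 v) \<longleftrightarrow> v < n"
| "valid n (V2 v) \<longleftrightarrow> v < n"
| "valid n (L u k) \<longleftrightarrow> u < n \<and> k < 2 * n + 2"

definition num_states :: "nat \<Rightarrow> nat" where
  "num_states n = 6 * n + 1 + n * (2 * n + 2)"

lemma mult_add_eqD:
  fixes k m :: nat
  assumes "u * m + k = u' * m + k'" "k < m" "k' < m"
  shows "u = u'" "k = k'"
proof -
  have "(u * m + k) div m = u" "(u' * m + k') div m = u'" using assms(2,3) by simp_all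
  then show "u = u'" using assms(1) by simp
  then show "k = k'" using assms(1) by simp
qed

lemma enc_inj: "valid n p \<Longrightarrow> valid n q \<Longrightarrow> enc n p = enc n q \<Longrightarrow> p = q"
  by (cases p; cases q) (auto dest: mult_add_eqD simp del: mult_Suc_right add_mult_distrib2)

lemma enc_less: "valid n p \<Longrightarrow> enc n p < num_states n"
proof (cases p)
  case (L u k)
  assume "valid n p"
  then have "u * (2 * n + 2) + k < (u + 1) * (2 * n + 2)" "(u + 1) * (2 * n + 2) \<le> n * (2 * n + 2)"
    using L by (simp, intro mult_right_mono) auto
  then show ?thesis using L by (simp add: num_states_def)
qed (auto simp: num_states_def)

section \<open>Oriented edges and the list of transitions\<close>

fun up_edge :: "nat \<times> nat \<Rightarrow> nat \<times> nat" where
  "up_edge (u, v) = (min u v, max u v)"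

definition chain_trans :: "nat \<Rightarrow> (st \<times> nat option \<times> st) list" where
  "chain_trans n = map (\<lambda>j. (C j, Some 2, C (Suc j))) [0..<4 * n]"

text \<open>No letter leads from \<open>L u n\<close> to \<open>L u (n + 1)\<close>. Only three edge
  transitions bridge this gap, and they may arrive on the line of another vertex. The runs have full
  length for every \<open>u\<close>, which keeps all lines alike for the generator.\<close>

definition line_trans :: "nat \<Rightarrow> nat \<Rightarrow> (st \<times> nat option \<times> st) list" where
  "line_trans n u =
     [(C (2 * (n - u)), None, L u (n - u)), (L u (2 * n + 1 - u), None, C (2 * n + 2 * (n - u)))] @
     map (\<lambda>k. (L u k, Some 1, L u (Suc k))) [0..<n] @
     map (\<lambda>k. (L u k, Some 1, L u (Suc k))) [n + 1..<2 * n + 1]"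

text \<open>The last transition uses its edge downwards, from the larger end to the smaller. With
  upward edges everywhere else, a triangle has exactly one closed walk, starting at its least
  vertex.\<close>

definition edge_trans :: "nat \<Rightarrow> nat \<times> nat \<Rightarrow> (st \<times> nat option \<times> st) list" where
  "edge_trans n = (\<lambda>(a, b). [(L a n, None, V1 b), (V1 a, None, V2 b), (V2 b, None, L a (n + 1))])"

definition trans_list :: "nat \<Rightarrow> (nat \<times> nat) list \<Rightarrow> (st \<times> nat option \<times> st) list" where
  "trans_list n es =
     chain_trans n @ concat (map (line_trans n) [0..<n]) @ concat (map (edge_trans n \<circ> up_edge) es)"

text \<open>An encoded automaton lists each transition once, so the generated list must be free of
  duplicates.\<close>

lemma distinct_trans_list:
  assumes "distinct (map up_edge es)"
  shows "distinct (trans_list n es)"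
proof -
  have 1: "distinct (chain_trans n)" "\<And>u. distinct (line_trans n u)"
    by (auto simp: chain_trans_def line_trans_def distinct_map inj_on_def)
  have 2: "distinct (concat (map (line_trans n) us))" if "distinct us" "set us \<subseteq> {..<n}" for us
    using that by (induction us) (auto simp: 1, auto simp: line_trans_def)
  have 3: "distinct (concat (map (edge_trans n) ps))" if "distinct ps" for ps
    using that by (induction ps) (auto simp: edge_trans_def)
  have "distinct (concat (map (edge_trans n \<circ> up_edge) es))"
    using 3[OF assms] by simp
  moreover have "distinct (concat (map (line_trans n) [0..<n]))"
    by (intro 2) auto
  \<comment> \<open>The label 2 separates the chain from the rest, and \<open>isV\<close> separates
    the edge transitions from the lines.\<close>
  moreover define isV :: "st \<times> nat option \<times> st \<Rightarrow> bool"
    where "isV = (\<lambda>(p, x, q). \<exists>v. p = V1 v \<or> p = V2 v \<or> q = V1 v)"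
  have "\<forall>t \<in> set (chain_trans n). fst (snd t) = Some 2"
    by (auto simp: chain_trans_def)
  moreover have line: "\<forall>t \<in> set (line_trans n u). fst (snd t) \<noteq> Some 2 \<and> \<not> isV t" for u
    by (auto simp: line_trans_def isV_def)
  then have "\<forall>t \<in> set (concat (map (line_trans n) [0..<n])). fst (snd t) \<noteq> Some 2 \<and> \<not> isV t"
    by (simp del: split_paired_All)
  moreover have edge: "\<forall>t \<in> set (edge_trans n e). fst (snd t) \<noteq> Some 2 \<and> isV t" for e
    by (cases e) (simp add: edge_trans_def isV_def)
  then have "\<forall>t \<in> set (concat (map (edge_trans n \<circ> up_edge) es)). fst (snd t) \<noteq> Some 2 \<and> isV t"
    by (simp del: split_paired_All)
  ultimately show ?thesis
    using 1(1) unfolding trans_list_def distinct_append set_append by blast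
qed

lemma length_trans_list: "length (trans_list n es) = 4 * n + n * (2 * n + 2) + 3 * length es"
proof -
  have "length (line_trans n u) = 2 * n + 2" for u
    by (simp add: line_trans_def)
  then have "length (concat (map (line_trans n) [0..<n])) = n * (2 * n + 2)"
    by (simp add: length_concat comp_def sum_list_triv del: mult_Suc_right add_2_eq_Suc')
  moreover have "length (edge_trans n e) = 3" for e
    by (simp add: edge_trans_def split: prod.splits)
  then have "length (concat (map (edge_trans n \<circ> up_edge) es)) = 3 * length es"
    by (simp add: length_concat comp_def sum_list_triv)
  ultimately show ?thesis by (simp add: trans_list_def chain_trans_def)
qed

lemma trans_list_cases:
  assumes "(p, x, q) \<in> set (trans_list n es)"
  obtains (chain) j where "j < 4 * n" "p = C j" "x = Some 2" "q = C (Suc j)"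
  | (enter) u where "u < n" "p = C (2 * (n - u))" "x = None" "q = L u (n - u)"
  | (leave) u where "u < n" "p = L u (2 * n + 1 - u)" "x = None" "q = C (2 * n + 2 * (n - u))"
  | (line) u k where "u < n" "k < n \<or> n + 1 \<le> k \<and> k < 2 * n + 1" "p = L u k" "x = Some 1" "q = L u (Suc k)"
  | (edge1) a b where "(a, b) \<in> up_edge ` set es" "p = L a n" "x = None" "q = V1 b"
  | (edge2) a b where "(a, b) \<in> up_edge ` set es" "p = V1 a" "x = None" "q = V2 b"
  | (edge3) a b where "(a, b) \<in> up_edge ` set es" "p = V2 b" "x = None" "q = L a (n + 1)"
proof -
  consider "(p, x, q) \<in> set (chain_trans n)" | u where "u < n" "(p, x, q) \<in> set (line_trans n u)"
    | e where "e \<in> set es" "(p, x, q) \<in> set (edge_trans n (up_edge e))"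
    using assms unfolding trans_list_def set_append set_concat set_map by fastforce
  then show thesis
  proof cases
    case 1
    then show ?thesis using chain by (auto simp: chain_trans_def)
  next
    case 2
    then show ?thesis using enter[OF 2(1)] leave[OF 2(1)] line[OF 2(1)]
      by (auto simp: line_trans_def)
  next
    case 3
    obtain a b where ab: "up_edge e = (a, b)" by (cases "up_edge e")
    then have "(a, b) \<in> up_edge ` set es" using imageI[OF 3(1), of up_edge] by simp
    from edge1[OF this] edge2[OF this] edge3[OF this] show ?thesis
      using 3(2) unfolding ab by (auto simp: edge_trans_def)
  qed
qed

lemma trans_listI:
  "j < 4 * n \<Longrightarrow> (C j, Some 2, C (Suc j)) \<in> set (trans_list n es)"
  "u < n \<Longrightarrow> (C (2 * (n - u)), None, L u (n - u)) \<in> set (trans_list n es)"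
  "u < n \<Longrightarrow> (L u (2 * n + 1 - u), None, C (2 * n + 2 * (n - u))) \<in> set (trans_list n es)"
  "u < n \<Longrightarrow> k < n \<or> n + 1 \<le> k \<and> k < 2 * n + 1 \<Longrightarrow>
     (L u k, Some 1, L u (Suc k)) \<in> set (trans_list n es)"
  "(a, b) \<in> up_edge ` set es \<Longrightarrow> (L a n, None, V1 b) \<in> set (trans_list n es)"
  "(a, b) \<in> up_edge ` set es \<Longrightarrow> (V1 a, None, V2 b) \<in> set (trans_list n es)"
  "(a, b) \<in> up_edge ` set es \<Longrightarrow> (V2 b, None, L a (n + 1)) \<in> set (trans_list n es)"
proof -
  show "(C j, Some 2, C (Suc j)) \<in> set (trans_list n es)" if "j < 4 * n"
    using that by (simp add: trans_list_def chain_trans_def image_iff)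
  have line: "t \<in> set (trans_list n es)" if "u < n" "t \<in> set (line_trans n u)" for t
    using that by (auto simp: trans_list_def)
  show "u < n \<Longrightarrow> (C (2 * (n - u)), None, L u (n - u)) \<in> set (trans_list n es)"
    "u < n \<Longrightarrow> (L u (2 * n + 1 - u), None, C (2 * n + 2 * (n - u))) \<in> set (trans_list n es)"
    "u < n \<Longrightarrow> k < n \<or> n + 1 \<le> k \<and> k < 2 * n + 1 \<Longrightarrow>
      (L u k, Some 1, L u (Suc k)) \<in> set (trans_list n es)"
    by (rule line, assumption, simp add: line_trans_def image_iff del: upt_Suc)+
  have edge: "t \<in> set (trans_list n es)"
    if e: "(a, b) \<in> up_edge ` set es" "t \<in> set (edge_trans n (a, b))" for t
  proof -
    obtain e where "e \<in> set es" "up_edge e = (a, b)" using e(1) by (rule imageE) simp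
    then show ?thesis using e(2) by (auto simp: trans_list_def intro!: bexI[of _ e])
  qed
  show "(a, b) \<in> up_edge ` set es \<Longrightarrow> (L a n, None, V1 b) \<in> set (trans_list n es)"
    "(a, b) \<in> up_edge ` set es \<Longrightarrow> (V1 a, None, V2 b) \<in> set (trans_list n es)"
    "(a, b) \<in> up_edge ` set es \<Longrightarrow> (V2 b, None, L a (n + 1)) \<in> set (trans_list n es)"
    by (rule edge, assumption, simp add: edge_trans_def)+
qed

section \<open>The accepted strings\<close>

definition closing :: "nat \<Rightarrow> nat \<Rightarrow> nat list" where
  "closing n u = replicate (n - u) 1 @ replicate (2 * u) 2"

definition walk_string :: "nat \<Rightarrow> nat \<Rightarrow> nat \<Rightarrow> nat list" where
  "walk_string n u u' = replicate (2 * (n - u)) 2 @ replicate u 1 @ closing n u'"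

definition walk :: "(nat \<times> nat) set \<Rightarrow> nat \<Rightarrow> nat \<Rightarrow> bool" where
  "walk D u u' \<longleftrightarrow> (\<exists>v x. (u, v) \<in> D \<and> (v, x) \<in> D \<and> (u', x) \<in> D)"

text \<open>A closed form for the strings that lead from each state to the end of the chain. A chain
  state beyond \<open>2 * (n - u)\<close> has missed the entry to the line of \<open>u\<close>; a
  line state beyond its exit accepts nothing.\<close>

fun accepted :: "nat \<Rightarrow> (nat \<times> nat) set \<Rightarrow> st \<Rightarrow> nat list \<Rightarrow> bool" where
  "accepted n D (C j) y \<longleftrightarrow> y = replicate (4 * n - j) 2 \<or>
     (\<exists>u u'. walk D u u' \<and> j \<le> 2 * (n - u) \<and>
       y = replicate (2 * (n - u) - j) 2 @ replicate u 1 @ closing n u')"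
| "accepted n D (V1 v) y \<longleftrightarrow> (\<exists>x u'. (v, x) \<in> D \<and> (u', x) \<in> D \<and> y = closing n u')"
| "accepted n D (V2 x) y \<longleftrightarrow> (\<exists>u'. (u', x) \<in> D \<and> y = closing n u')"
| "accepted n D (L u k) y \<longleftrightarrow>
     (if k \<le> n then \<exists>u'. walk D u u' \<and> y = replicate (n - k) 1 @ closing n u'
      else k \<le> 2 * n + 1 - u \<and> y = replicate (2 * n + 1 - u - k) 1 @ replicate (2 * u) 2)"

text \<open>\<open>path\<close> grows at its front, so the string that remains to be read is the
  natural invariant.\<close>

lemma path_accepted:
  assumes "path (set (trans_list n es)) p y r" "r = C (4 * n)"
    and D: "\<And>u v. (u, v) \<in> up_edge ` set es \<Longrightarrow> u < n"
  shows "accepted n (up_edge ` set es) p y"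
  using assms(1,2)
proof (induction rule: path.induct)
  case (path_refl q)
  then show ?case by simp
next
  case (path_eps p q y r)
  from path_eps.hyps(1) show ?case
  proof (cases rule: trans_list_cases)
    case (enter u)
    then obtain u' where "walk (up_edge ` set es) u u'" "y = replicate u 1 @ closing n u'"
      using path_eps by auto
    then show ?thesis
      unfolding enter accepted.simps by (intro disjI2 exI[of _ u] exI[of _ u']) simp
  next
    \<comment> \<open>The line rejoins the chain beyond \<open>2 * n\<close>, behind every entry to
      a line. So no second walk can follow, and only the rest of the chain is read.\<close>
    case (leave u)
    then show ?thesis using path_eps by auto
  next
    case (edge1 a b)
    then show ?thesis using path_eps by (auto simp: walk_def)
  next
    case (edge3 a b)
    then show ?thesis using path_eps D[of a b] by (auto simp: closing_def)
  qed (use path_eps in auto)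
next
  case (path_sym p a q y r)
  from path_sym.hyps(1) show ?case
  proof (cases rule: trans_list_cases)
    case (chain j)
    then have a: "a = 2" "accepted n (up_edge ` set es) (C (Suc j)) y" using path_sym by simp_all
    then consider "y = replicate (4 * n - Suc j) 2" | u u' where "walk (up_edge ` set es) u u'"
       "Suc j \<le> 2 * (n - u)" "y = replicate (2 * (n - u) - Suc j) 2 @ replicate u 1 @ closing n u'"
      by auto
    then show ?thesis
    proof cases
      case 1
      then have "a # y = replicate (4 * n - j) 2" using a chain by (simp flip: replicate_Suc add: Suc_diff_Suc)
      then show ?thesis using chain by simp
    next
      case 2
      then have "a # y = replicate (2 * (n - u) - j) 2 @ replicate u 1 @ closing n u'"
        using a by (simp flip: replicate_Suc append_Cons add: Suc_diff_Suc)
      then show ?thesis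
        unfolding chain accepted.simps using 2(1,2) by (intro disjI2 exI[of _ u] exI[of _ u']) simp
    qed
  next
    case (line u k)
    then have a: "a = 1" "accepted n (up_edge ` set es) (L u (Suc k)) y" using path_sym by simp_all
    show ?thesis
    proof (cases "k < n")
      case True
      then show ?thesis using a line by (auto simp flip: replicate_Suc append_Cons simp: Suc_diff_Suc)
    next
      case False
      then show ?thesis using a line by (auto simp flip: replicate_Suc append_Cons simp: Suc_diff_Suc)
    qed
  qed simp_all
qed

lemma path_append: "path \<delta> p y q \<Longrightarrow> path \<delta> q z r \<Longrightarrow> path \<delta> p (y @ z) r"
  by (induction rule: path.induct) (auto intro: path.intros)

lemma path_run:
  assumes "\<And>k. i \<le> k \<Longrightarrow> k < j \<Longrightarrow> (f k, Some a, f (Suc k)) \<in> \<delta>" "i \<le> j"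
  shows "path \<delta> (f i) (replicate (j - i) a) (f j)"
  using assms
proof (induction "j - i" arbitrary: i)
  case 0
  then show ?case by (simp add: path_refl)
next
  case (Suc d)
  then have "path \<delta> (f (Suc i)) (replicate (j - Suc i) a) (f j)" by auto
  moreover have "j - i = Suc (j - Suc i)" "(f i, Some a, f (Suc i)) \<in> \<delta>" using Suc by auto
  ultimately show ?case by (simp add: path_sym)
qed

lemma path_run':
  assumes "\<And>k. i \<le> k \<Longrightarrow> k < j \<Longrightarrow> (f k, Some a, f (Suc k)) \<in> \<delta>" "i \<le> j" "path \<delta> (f j) z r"
    "y = replicate (j - i) a @ z"
  shows "path \<delta> (f i) y r"
  using path_append[OF path_run[of i j f a \<delta>] assms(3)] assms by simp

lemma path_walk:
  assumes "walk (up_edge ` set es) u u'" "u < n" "u' < n"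
  shows "path (set (trans_list n es)) (C 0) (walk_string n u u') (C (4 * n))"
proof -
  let ?\<delta> = "set (trans_list n es)"
  from assms obtain v x where E: "(u, v) \<in> up_edge ` set es" "(v, x) \<in> up_edge ` set es"
    "(u', x) \<in> up_edge ` set es" unfolding walk_def by blast
  have "path ?\<delta> (C (2 * n + 2 * (n - u'))) (replicate (2 * u') 2) (C (4 * n))"
    using path_run[of "2 * n + 2 * (n - u')" "4 * n" C 2 ?\<delta>] assms trans_listI(1)[of _ n es]
    by (simp add: diff_mult_distrib2)
  then have "path ?\<delta> (L u' (2 * n + 1 - u')) (replicate (2 * u') 2) (C (4 * n))"
    using assms path_eps trans_listI(3) by metis
  then have "path ?\<delta> (L u' (n + 1)) (closing n u') (C (4 * n))"
    using assms trans_listI(4)[of u' n _ es]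
    by (intro path_run'[of "n + 1" "2 * n + 1 - u'" "L u'" 1 ?\<delta>]) (auto simp: closing_def)
  then have "path ?\<delta> (V2 x) (closing n u') (C (4 * n))"
    using path_eps trans_listI(7)[OF E(3)] by metis
  then have "path ?\<delta> (V1 v) (closing n u') (C (4 * n))"
    using path_eps trans_listI(6)[OF E(2)] by metis
  then have "path ?\<delta> (L u n) (closing n u') (C (4 * n))"
    using path_eps trans_listI(5)[OF E(1)] by metis
  then have "path ?\<delta> (L u (n - u)) (replicate u 1 @ closing n u') (C (4 * n))"
    using assms trans_listI(4)[of u n _ es]
    by (intro path_run'[of "n - u" n "L u" 1 ?\<delta>]) auto
  then have "path ?\<delta> (C (2 * (n - u))) (replicate u 1 @ closing n u') (C (4 * n))"
    using assms path_eps trans_listI(2) by metis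
  then show ?thesis unfolding walk_string_def
    using assms trans_listI(1)[of _ n es]
    by (intro path_run'[of 0 "2 * (n - u)" C 2 ?\<delta>]) auto
qed

section \<open>From named to numbered states\<close>

abbreviation enc_trans :: "nat \<Rightarrow> st \<times> nat option \<times> st \<Rightarrow> nat \<times> nat option \<times> nat" where
  "enc_trans n \<equiv> \<lambda>(p, x, q). (enc n p, x, enc n q)"

definition walk_nfa :: "nat \<Rightarrow> (nat \<times> nat) list \<Rightarrow> (nat, nat) enfa" where
  "walk_nfa n es =
     \<lparr>states = {..<num_states n}, alphabet = {1..2}, init = 0, final = 4 * n,
      trans = enc_trans n ` set (trans_list n es)\<rparr>"

text \<open>Injectivity is asked for on \<open>S\<close> only, because \<open>enc n\<close> confuses
  states outside the valid range.\<close>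

lemma path_image_iff:
  assumes inj: "inj_on f S" and sub: "\<And>p x q. (p, x, q) \<in> \<delta> \<Longrightarrow> p \<in> S \<and> q \<in> S"
    and "p \<in> S" "r \<in> S"
  shows "path ((\<lambda>(p, x, q). (f p, x, f q)) ` \<delta>) (f p) y (f r) \<longleftrightarrow> path \<delta> p y r"
proof
  let ?\<delta> = "(\<lambda>(p, x, q). (f p, x, f q)) ` \<delta>"
  have im: "(f p, x, f q) \<in> ?\<delta>" if "(p, x, q) \<in> \<delta>" for p x q
    using that by (rule rev_image_eqI) simp
  assume "path \<delta> p y r"
  then show "path ?\<delta> (f p) y (f r)"
  proof (induction rule: path.induct)
    case (path_refl q)
    show ?case by (rule path.path_refl)
  next
    case (path_eps p q u r)
    show ?case using path.path_eps[OF im[OF path_eps.hyps(1)] path_eps.IH] .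
  next
    case (path_sym p a q u r)
    show ?case using path.path_sym[OF im[OF path_sym.hyps(1)] path_sym.IH] .
  qed
next
  have "path \<delta> p y r" if "path ((\<lambda>(p, x, q). (f p, x, f q)) ` \<delta>) p' y r'"
    "p' = f p" "r' = f r" "p \<in> S" "r \<in> S" for p' r' p r
    using that
  proof (induction arbitrary: p rule: path.induct)
    case (path_refl q)
    then show ?case using inj_onD[OF inj, of p r] by (simp add: path.path_refl)
  next
    case (path_eps p' q' y r')
    then obtain p1 q where t: "(p1, None, q) \<in> \<delta>" "p' = f p1" "q' = f q" by auto
    have "p1 = p" "q \<in> S"
      using sub[OF t(1)] t(2) path_eps.prems(1,3) inj_onD[OF inj, of p1 p] by simp_all
    then show ?case using path_eps.IH[OF t(3) path_eps.prems(2)] path_eps.prems(4) t(1)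
      by (simp add: path.path_eps)
  next
    case (path_sym p' a q' y r')
    then obtain p1 q where t: "(p1, Some a, q) \<in> \<delta>" "p' = f p1" "q' = f q" by auto
    have "p1 = p" "q \<in> S"
      using sub[OF t(1)] t(2) path_sym.prems(1,3) inj_onD[OF inj, of p1 p] by simp_all
    then show ?case using path_sym.IH[OF t(3) path_sym.prems(2)] path_sym.prems(4) t(1)
      by (simp add: path.path_sym)
  qed
  then show "path ((\<lambda>(p, x, q). (f p, x, f q)) ` \<delta>) (f p) y (f r) \<Longrightarrow> path \<delta> p y r"
    using assms by blast
qed

lemma trans_list_valid:
  assumes "set es \<subseteq> {..<n} \<times> {..<n}"
    and "(p, x, q) \<in> set (trans_list n es)"
  shows "valid n p \<and> valid n q"
  using assms(2) by (cases rule: trans_list_cases) (use assms(1) in \<open>auto simp: min_def max_def\<close>)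

lemma lang_walk_nfa:
  assumes "set es \<subseteq> {..<n} \<times> {..<n}"
  shows "y \<in> lang (walk_nfa n es) \<longleftrightarrow> path (set (trans_list n es)) (C 0) y (C (4 * n))"
  using path_image_iff[of "enc n" "{q. valid n q}" "set (trans_list n es)" "C 0" "C (4 * n)" y]
    enc_inj[of n] trans_list_valid[OF assms]
  by (auto simp: lang_def walk_nfa_def inj_on_def)

lemma walk_less:
  assumes "set es \<subseteq> {..<n} \<times> {..<n}" "walk (up_edge ` set es) u u'"
  shows "u < n \<and> u' < n"
proof -
  have "u < n" if "(u, v) \<in> up_edge ` set es" for u v
    using that assms(1) by (auto simp: min_def)
  then show ?thesis using assms(2) unfolding walk_def by blast
qed

lemma lang_walk_nfaD:
  assumes "set es \<subseteq> {..<n} \<times> {..<n}" "y \<in> lang (walk_nfa n es)"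
  shows "y = replicate (4 * n) 2 \<or>
    (\<exists>u u'. u < n \<and> u' < n \<and> walk (up_edge ` set es) u u' \<and> y = walk_string n u u')"
proof -
  have D: "u < n" if "(u, v) \<in> up_edge ` set es" for u v
    using that assms(1) by (auto simp: min_def)
  have "accepted n (up_edge ` set es) (C 0) y"
    using assms D by (intro path_accepted) (auto simp: lang_walk_nfa)
  then consider "y = replicate (4 * n) 2"
    | u u' where "walk (up_edge ` set es) u u'" "y = walk_string n u u'"
    unfolding accepted.simps walk_string_def minus_nat.diff_0 by blast
  then show ?thesis
  proof cases
    case (2 u u')
    then show ?thesis using walk_less[OF assms(1) 2(1)] by blast
  qed blast
qed

lemma walk_string_in_lang:
  assumes "set es \<subseteq> {..<n} \<times> {..<n}" "walk (up_edge ` set es) u u'"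
  shows "walk_string n u u' \<in> lang (walk_nfa n es)"
proof -
  have "u < n" "u' < n" using walk_less[OF assms] by simp_all
  then show ?thesis using assms by (simp add: lang_walk_nfa path_walk)
qed

section \<open>Letter counts and optimal lengths\<close>

lemma count_list_replicate: "count_list (replicate k a) b = (if a = b then k else 0)"
  by (induction k) auto

lemma count_list_subseq: "subseq xs ys \<Longrightarrow> count_list xs a \<le> count_list ys a"
  by (induction rule: list_emb.induct) auto

text \<open>Sums replace differences, as subtraction truncates. Together with
  \<open>count_walk_string\<close> this gives the constant sum \<open>4 * n\<close> of length and
  number of letters 1.\<close>

lemma length_walk_string: "u \<le> n \<Longrightarrow> u' \<le> n \<Longrightarrow> length (walk_string n u u') + u = 3 * n + u'"
  by (simp add: walk_string_def closing_def)

lemma count_walk_string: "u' \<le> n \<Longrightarrow> count_list (walk_string n u u') 1 + u' = n + u"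
  by (simp add: walk_string_def closing_def count_list_replicate)

text \<open>
  The factor \<open>\<kappa>\<close> is 2 for subsequences, where enough letters \<open>b\<close> must be available, and 0 for
  supersequences, where only the number of letters \<open>a\<close> matters.
\<close>

definition padded :: "nat \<Rightarrow> nat \<Rightarrow> nat list" where
  "padded \<kappa> n = replicate (\<kappa> * n) 2 @ replicate n 1 @ replicate (\<kappa> * n) 2"

lemma count_padded: "count_list (padded \<kappa> n) 1 = n"
  by (simp add: padded_def count_list_replicate)

lemma min_subseq_iff:
  assumes es: "set es \<subseteq> {..<n} \<times> {..<n}" and n: "n > 0"
    and ans: "min_subseq_answer (padded 2 n) (walk_nfa n es) ans"
  shows "(\<exists>y. ans = Match y \<and> length y = 3 * n) \<longleftrightarrow> (\<exists>u. walk (up_edge ` set es) u u)"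
proof -
  let ?W = "walk (up_edge ` set es)" and ?w = "padded 2 n" and ?L = "lang (walk_nfa n es)"
  have lower: "length y \<ge> 3 * n \<and> (length y = 3 * n \<longrightarrow> (\<exists>u. ?W u u))"
    if y: "y \<in> ?L" "subseq y ?w" for y
    using lang_walk_nfaD[OF es y(1)]
  proof (elim disjE exE conjE)
    fix u u' assume *: "u < n" "u' < n" "?W u u'" "y = walk_string n u u'"
    have "n + u \<le> n + u'"
      using count_walk_string[of u' n u] count_list_subseq[OF y(2), of 1] * by (simp add: count_padded[simplified])
    then show ?thesis using length_walk_string[of u n u'] * by auto
  \<comment> \<open>What remains is the string of the whole chain, which is longer than
    \<open>3 * n\<close> because \<open>n > 0\<close>.\<close>
  qed (use n in auto)
  have upper: "\<exists>y \<in> ?L. subseq y ?w \<and> length y = 3 * n" if W: "?W u u" for u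
  proof -
    have u: "u < n" using walk_less[OF es W] by simp
    have eq: "walk_string n u u = replicate (2 * (n - u)) 2 @ replicate n 1 @ replicate (2 * u) 2"
      using u by (simp add: walk_string_def closing_def flip: replicate_add)
    have "subseq (replicate k a) (replicate l a)" if "k \<le> l" for k l and a :: nat
      using that by (metis le_add_diff_inverse list_emb_prefix replicate_add subseq_order.refl)
    then have "subseq (walk_string n u u) ?w"
      unfolding eq padded_def using u by (intro list_emb_append_mono) auto
    then show ?thesis using walk_string_in_lang[OF es W] length_walk_string[of u n u] u by auto
  qed
  show ?thesis
    using ans lower upper
    by (cases ans) (auto simp: min_subseq_answer_def is_arg_min_linorder antisym, (metis le_antisym)+)
qed

lemma max_superseq_iff:
  assumes es: "set es \<subseteq> {..<n} \<times> {..<n}" and n: "n > 0"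
    and ans: "max_superseq_answer (padded 0 n) (walk_nfa n es) ans"
  shows "(\<exists>y. ans = Match y \<and> length y = 3 * n) \<longleftrightarrow> (\<exists>u. walk (up_edge ` set es) u u)"
proof -
  let ?W = "walk (up_edge ` set es)" and ?w = "padded 0 n" and ?L = "lang (walk_nfa n es)"
  have upper: "length y \<le> 3 * n \<and> (length y = 3 * n \<longrightarrow> (\<exists>u. ?W u u))"
    if y: "y \<in> ?L" "subseq ?w y" for y
    using lang_walk_nfaD[OF es y(1)]
  proof (elim disjE exE conjE)
    fix u u' assume *: "u < n" "u' < n" "?W u u'" "y = walk_string n u u'"
    have "n + u' \<le> n + u"
      using count_walk_string[of u' n u] count_list_subseq[OF y(2), of 1] * by (simp add: count_padded[simplified])
    then show ?thesis using length_walk_string[of u n u'] * by auto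
  next
    \<comment> \<open>This string contains no letter 1, but a match needs \<open>n > 0\<close> of
      them.\<close>
    assume "y = replicate (4 * n) 2"
    then show ?thesis
      using count_list_subseq[OF y(2), of 1] n by (simp add: count_padded[simplified] count_list_replicate)
  qed
  have lower: "\<exists>y \<in> ?L. subseq ?w y \<and> length y = 3 * n" if W: "?W u u" for u
  proof -
    have u: "u < n" using walk_less[OF es W] by simp
    have eq: "walk_string n u u = replicate (2 * (n - u)) 2 @ replicate n 1 @ replicate (2 * u) 2"
      using u by (simp add: walk_string_def closing_def flip: replicate_add)
    have "subseq ?w (walk_string n u u)"
      unfolding eq padded_def by (intro list_emb_append_mono) auto
    then show ?thesis using walk_string_in_lang[OF es W] length_walk_string[of u n u] u by auto
  qed
  show ?thesis
  proof (cases ans)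
    case Unbounded
    \<comment> \<open>\<open>upper\<close> bounds the length of all matches, so this answer is never
      correct.\<close>
    then show ?thesis using ans upper by (auto simp: max_superseq_answer_def) (meson not_le)
  qed (use ans lower upper in \<open>auto simp: max_superseq_answer_def is_arg_max_linorder antisym,
        (metis le_antisym)+\<close>)
qed

section \<open>Triangles as closed walks\<close>

lemma has_triangle_iff_walk:
  assumes "is_graph (n, E)" "(\<lambda>(u, v). {u, v}) ` set es = E"
  shows "has_triangle (n, E) \<longleftrightarrow> (\<exists>u. walk (up_edge ` set es) u u)"
proof -
  have E: "{u, v} \<in> E \<Longrightarrow> u < n \<and> v < n \<and> u \<noteq> v" for u v
    using assms(1) by (fastforce simp: is_graph_def doubleton_eq_iff)
  have D: "(u, v) \<in> up_edge ` set es \<longleftrightarrow> u < v \<and> {u, v} \<in> E" for u v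
  proof
    assume "(u, v) \<in> up_edge ` set es"
    then obtain a b where "(a, b) \<in> set es" "u = min a b" "v = max a b" by auto
    then have "{u, v} \<in> E" using assms(2) by (auto simp: min_def max_def insert_commute intro!: rev_image_eqI)
    then show "u < v \<and> {u, v} \<in> E" using E \<open>u = _\<close> \<open>v = _\<close> by (fastforce simp: min_def max_def)
  next
    assume "u < v \<and> {u, v} \<in> E"
    then obtain a b where "(a, b) \<in> set es" "{u, v} = {a, b}" "u < v" using assms(2) by auto
    then show "(u, v) \<in> up_edge ` set es" by (force simp: doubleton_eq_iff)
  qed
  show ?thesis
  proof
    assume "has_triangle (n, E)"
    then obtain S where S: "card S = 3" "\<forall>u \<in> S. \<forall>v \<in> S. u \<noteq> v \<longrightarrow> {u, v} \<in> E"
      by (auto simp: has_triangle_def)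
    then obtain a b c where *: "S = {a, b, c}" "a \<noteq> b" "b \<noteq> c" "a \<noteq> c" by (auto simp: card_3_iff)
    \<comment> \<open>Sorting the three vertices turns the edges of the triangle into upward
      edges.\<close>
    have **: "\<exists>u v x. u \<in> S \<and> v \<in> S \<and> x \<in> S \<and> u < v \<and> v < x"
      unfolding * using *(2-4) by (auto simp: not_less linorder_neq_iff)
    then obtain u v x where "u \<in> S" "v \<in> S" "x \<in> S" "u < v" "v < x" by blast
    then have "walk (up_edge ` set es) u u" unfolding walk_def D using S(2)
      by (intro exI[of _ v] exI[of _ x]) auto
    then show "\<exists>u. walk (up_edge ` set es) u u" ..
  next
    assume "\<exists>u. walk (up_edge ` set es) u u"
    then obtain u v x where "u < v" "v < x" "{u, v} \<in> E" "{v, x} \<in> E" "{u, x} \<in> E"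
      unfolding walk_def D by blast
    then show "has_triangle (n, E)" using E[of u v] E[of v x]
      by (auto simp: has_triangle_def insert_commute intro!: exI[of _ "{u, v, x}"])
  qed
qed

section \<open>Output from back to front\<close>

lemma wps_append: "wps B (xs @ ys) Q = wps B xs (wps B ys Q)"
  by (induction xs) simp_all

lemma wpi_mono: "wpi B i P R M \<Longrightarrow> (\<And>R M. P R M \<Longrightarrow> Q R M) \<Longrightarrow> wpi B i Q R M"
  by (cases i) auto

lemma wps_mono: "wps B is P R M \<Longrightarrow> (\<And>R M. P R M \<Longrightarrow> Q R M) \<Longrightarrow> wps B is Q R M"
proof (induction "is" arbitrary: R M)
  case (Cons i "is")
  show ?case using wpi_mono[OF Cons.prems(1)[unfolded wps.simps], of "wps B is Q"] Cons.IH Cons.prems(2)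
    by simp
qed simp

datatype op = OSet nat nat | OBin binop nat nat nat | OGet nat nat | OPush nat

text \<open>
  Output is written from back to front, below the address \<open>len\<close>: register 0 points to the lowest
  cell written so far, and register 1 must contain 1. In \<open>lift len M0 A\<close>, the list \<open>S\<close> is the
  output so far and \<open>M0\<close> the initial memory, which is intact below register 0. Assertions do not
  see register 0, as its value is \<open>len - length S\<close>.
\<close>

fun op_code :: "op \<Rightarrow> instr list" where
  "op_code (OSet d k) = [Const d k]"
| "op_code (OBin f d s t) = [Binop f d s t]"
| "op_code (OGet d r) = [Load d r]"
| "op_code (OPush r) = [Binop Minus 0 0 1, Store 0 r]"

definition ops_code :: "op list \<Rightarrow> code" where
  "ops_code os = (\<lambda>_. concat (map op_code os))"

type_synonym out_assn = "(nat \<Rightarrow> nat) \<Rightarrow> nat list \<Rightarrow> bool"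

definition lift :: "nat \<Rightarrow> (nat \<Rightarrow> nat) \<Rightarrow> out_assn \<Rightarrow> assn" where
  "lift len M0 A R M \<longleftrightarrow> (\<exists>S. R 0 + length S = len \<and>
     M = (\<lambda>a. if a < R 0 then M0 a else nth_default 0 S (a - R 0)) \<and> A (R(0 := 0)) S)"

text \<open>A read is allowed only below the output, where the initial memory is intact; a write
  needs room, so that register 0 does not get stuck at 0. Other operations must avoid register 0,
  which the assertions do not see.\<close>

fun owp :: "nat \<Rightarrow> (nat \<Rightarrow> nat) \<Rightarrow> nat \<Rightarrow> op \<Rightarrow> out_assn \<Rightarrow> out_assn" where
  "owp len M0 B (OSet d k) A R S = (d \<noteq> 0 \<and> k \<le> B \<and> A (R(d := k)) S)"
| "owp len M0 B (OBin f d s t) A R S = (d \<noteq> 0 \<and> s \<noteq> 0 \<and> t \<noteq> 0 \<and>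
     apply_binop f (R s) (R t) \<le> B \<and> A (R(d := apply_binop f (R s) (R t))) S)"
| "owp len M0 B (OGet d r) A R S =
     (d \<noteq> 0 \<and> r \<noteq> 0 \<and> R r + length S < len \<and> A (R(d := M0 (R r))) S)"
| "owp len M0 B (OPush r) A R S = (r \<noteq> 0 \<and> R 1 = 1 \<and> length S < len \<and> A R (R r # S))"

fun owps :: "nat \<Rightarrow> (nat \<Rightarrow> nat) \<Rightarrow> nat \<Rightarrow> op list \<Rightarrow> out_assn \<Rightarrow> out_assn" where
  "owps len M0 B [] A = A"
| "owps len M0 B (i # os) A = owp len M0 B i (owps len M0 B os A)"

lemma owp_wps:
  assumes "lift len M0 (owp len M0 B i A) R M" "len \<le> B"
  shows "wps B (op_code i) (lift len M0 A) R M"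
proof -
  obtain S where S: "R 0 + length S = len" "owp len M0 B i A (R(0 := 0)) S"
    "M = (\<lambda>a. if a < R 0 then M0 a else nth_default 0 S (a - R 0))"
    using assms(1) by (auto simp: lift_def)
  show ?thesis
  proof (cases i)
    case (OSet d k)
    then show ?thesis using S by (auto simp: lift_def fun_upd_twist intro!: exI[of _ S])
  next
    case (OBin f d s t)
    then show ?thesis using S by (auto simp: lift_def fun_upd_twist intro!: exI[of _ S])
  next
    case (OGet d r)
    then show ?thesis using S by (auto simp: lift_def fun_upd_twist intro!: exI[of _ S])
  next
    case (OPush r)
    then have "R 0 > 0" "R 1 = 1" "r \<noteq> 0" using S by auto
    moreover have "M(R 0 - 1 := R r) =
        (\<lambda>a. if a < R 0 - 1 then M0 a else nth_default 0 (R r # S) (a - (R 0 - 1)))"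
      using \<open>R 0 > 0\<close> unfolding S(3)
      by (auto simp: fun_eq_iff nth_default_Cons split: nat.split intro!: arg_cong[of _ _ "nth_default 0 S"])
    ultimately show ?thesis using OPush S(1,2) assms(2)
      by (auto simp: lift_def intro!: exI[of _ "R r # S"])
  qed
qed

lemma lift_mono: "lift len M0 A R M \<Longrightarrow> (\<And>R S. A R S \<Longrightarrow> A' R S) \<Longrightarrow> lift len M0 A' R M"
  unfolding lift_def by blast

lemma owps_wps:
  "lift len M0 (owps len M0 B os A) R M \<Longrightarrow> len \<le> B \<Longrightarrow>
   wps B (concat (map op_code os)) (lift len M0 A) R M"
proof (induction os arbitrary: R M)
  case (Cons i os)
  then show ?case using wps_mono[OF owp_wps[of len M0 B i "owps len M0 B os A" R M]]
    by (simp add: wps_append)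
qed simp

lemma length_ops_code: "length (concat (map op_code os)) \<le> 2 * length os"
proof (induction os)
  case (Cons i os)
  then show ?case by (cases i) auto
qed simp

lemma triple_ops:
  assumes "\<And>R S. A R S \<Longrightarrow> owps len M0 B os A' R S" "len \<le> B"
  shows "triple B (lift len M0 A) (ops_code os) (2 * length os) (lift len M0 A')"
proof -
  have "wps B (concat (map op_code os)) (lift len M0 A') R M" if "lift len M0 A R M" for R M
    using owps_wps[OF lift_mono[OF that assms(1)] assms(2)] by simp
  then show ?thesis
    unfolding ops_code_def using length_ops_code by (rule triple_wps)
qed

lemma triple_while_lift:
  assumes body: "\<And>i. i < k \<Longrightarrow> triple B (lift len M0 (I i)) cd T (lift len M0 (I (Suc i)))"
    and guard: "\<And>i R S. i \<le> k \<Longrightarrow> I i R S \<Longrightarrow> R r < R s \<longleftrightarrow> i < k" and "r \<noteq> 0" "s \<noteq> 0"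
  shows "triple B (lift len M0 (I 0)) (whilec r s cd) (k * (T + 2) + 2) (lift len M0 (I k))"
proof (rule triple_while[where I = "\<lambda>i. lift len M0 (I i)", OF body])
  show "R r < R s \<longleftrightarrow> i < k" if "i \<le> k" "lift len M0 (I i) R M" for i R M
    using that guard[of i "R(0 := 0)"] assms(3,4) by (auto simp: lift_def)
qed

text \<open>Register 15 runs down to register 16. As the output grows downwards, each transition is
  pushed target first; register \<open>l\<close> holds the code of its label.\<close>

definition run_code :: "nat \<Rightarrow> code" where
  "run_code l = whilec 16 15 (ops_code [OPush 15, OBin Minus 15 15 1, OPush l, OPush 15])"

definition run_out :: "nat \<Rightarrow> nat \<Rightarrow> nat \<Rightarrow> nat list" where
  "run_out x f k = concat (map (\<lambda>s. [s, x, Suc s]) [f..<f + k])"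

lemma length_run_out: "length (run_out x f k) = 3 * k"
  unfolding run_out_def by (simp add: length_concat comp_def sum_list_triv)

lemma run_out_Suc: "run_out x f (Suc k) = [f, x, Suc f] @ run_out x (Suc f) k"
  unfolding run_out_def by (subst upt_conv_Cons) auto

text \<open>\<open>F\<close> is a frame: facts that survive any change of register 15, here
  \<open>const_regs\<close> and, on lines, the vertex counter in register 25.\<close>

lemma triple_run:
  assumes F: "\<And>R y. F (R(15 := y)) = F R" "\<And>R. F R \<Longrightarrow> R 1 = 1 \<and> R l = x" and l: "l \<noteq> 15" "l \<noteq> 0"
    and len: "length S0 + 3 * k \<le> len" "len \<le> B" "f + k \<le> B"
  shows "triple B (lift len M0 (\<lambda>R S. F R \<and> R 15 = f + k \<and> R 16 = f \<and> S = S0)) (run_code l)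
     (k * 10 + 2) (lift len M0 (\<lambda>R S. F R \<and> R 15 = f \<and> R 16 = f \<and> S = run_out x f k @ S0))"
proof -
  let ?I = "\<lambda>i R S. F R \<and> R 15 = f + (k - i) \<and> R 16 = f \<and> S = run_out x (f + (k - i)) i @ S0"
  have "triple B (lift len M0 (?I 0))
      (whilec 16 15 (ops_code [OPush 15, OBin Minus 15 15 1, OPush l, OPush 15]))
      (k * (2 * length [OPush 15, OBin Minus 15 15 1, OPush l, OPush 15] + 2) + 2) (lift len M0 (?I k))"
  proof (rule triple_while_lift, rule triple_ops)
    fix i R S assume i: "i < k" and A: "?I i R S"
    define g where "g = f + (k - Suc i)"
    then have g: "f + (k - i) = Suc g" "Suc g \<le> B" using i len(3) by auto
    have R: "F R" "R (Suc 0) = Suc 0" "R l = x" "R 15 = Suc g" "R 16 = f"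
      "S = run_out x (Suc g) i @ S0"
      using A F(2)[of R] g by auto
    have "Suc (Suc (length S)) < len" using len(1) i by (simp add: R length_run_out)
    then show "owps len M0 B [OPush 15, OBin Minus 15 15 1, OPush l, OPush 15] (?I (Suc i)) R S"
      using R g(2) l by (simp add: F(1) run_out_Suc flip: g_def)
  qed (use len in auto)
  then show ?thesis by (simp add: run_code_def run_out_def)
qed

definition rep_code :: "nat \<Rightarrow> code" where
  "rep_code l = whilec 3 15 (ops_code [OBin Minus 15 15 1, OPush l])"

lemma triple_rep:
  assumes F: "\<And>R y. F (R(15 := y)) = F R" "\<And>R. F R \<Longrightarrow> R 1 = 1 \<and> R 3 = 0 \<and> R l = x"
    and l: "l \<noteq> 15" "l \<noteq> 0"
    and len: "length S0 + k \<le> len" "len \<le> B"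
  shows "triple B (lift len M0 (\<lambda>R S. F R \<and> R 15 = k \<and> S = S0)) (rep_code l)
     (k * 6 + 2) (lift len M0 (\<lambda>R S. F R \<and> S = replicate k x @ S0))"
proof -
  let ?I = "\<lambda>i R S. F R \<and> R 15 = k - i \<and> S = replicate i x @ S0"
  have "triple B (lift len M0 (?I 0)) (whilec 3 15 (ops_code [OBin Minus 15 15 1, OPush l]))
      (k * (2 * length [OBin Minus 15 15 1, OPush l] + 2) + 2) (lift len M0 (?I k))"
  proof (rule triple_while_lift, rule triple_ops)
    fix i R S assume i: "i < k" and A: "?I i R S"
    define g where "g = k - Suc i"
    then have g: "k - i = Suc g" "Suc g \<le> B" using i len by auto
    have R: "F R" "R (Suc 0) = Suc 0" "R l = x" "R 15 = Suc g" "S = replicate i x @ S0"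
      using A F(2)[of R] g by auto
    have "length S < len" using len(1) i by (simp add: R)
    then show "owps len M0 B [OBin Minus 15 15 1, OPush l] (?I (Suc i)) R S"
      using R g(2) l by (simp add: F(1) flip: g_def)
  next
    fix i R S assume "i \<le> k" "?I i R S"
    then show "R 3 < R 15 \<longleftrightarrow> i < k" using F(2)[of R] by auto
  qed (use len in auto)
  then show ?thesis unfolding rep_code_def
    by (rule triple_weaken) (simp, simp, erule lift_mono, simp)
qed

section \<open>Writing the matching instance\<close>

definition trans_code :: "nat \<Rightarrow> (st \<times> nat option \<times> st) list \<Rightarrow> nat list" where
  "trans_code n ts = concat (map (\<lambda>(p, x, q). [enc n p, label_code x, enc n q]) ts)"

lemma trans_code_append [simp]: "trans_code n (xs @ ys) = trans_code n xs @ trans_code n ys"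
  by (simp add: trans_code_def)

lemma length_trans_code: "length (trans_code n ts) = 3 * length ts"
  by (induction ts) (auto simp: trans_code_def)

lemma run_out_trans_code:
  assumes "\<And>i. i < k \<Longrightarrow> enc n (g (a + i)) = f + i" "\<And>i. i < k \<Longrightarrow> enc n (g (Suc (a + i))) = Suc (f + i)"
  shows "trans_code n (map (\<lambda>i. (g i, Some x, g (Suc i))) [a..<a + k]) = run_out x f k"
proof -
  have "[b..<b + k] = map (\<lambda>i. b + i) [0..<k]" for b
    using map_add_upt[of b k] by (simp add: add.commute)
  then show ?thesis
    unfolding trans_code_def run_out_def using assms
    by (auto simp: comp_def intro!: arg_cong[of _ _ concat])
qed

definition input_len :: "nat \<Rightarrow> nat \<Rightarrow> nat \<Rightarrow> nat" where
  "input_len \<kappa> n m = 6 + (2 * \<kappa> + 1) * n + 3 * (4 * n + n * (2 * n + 2) + 3 * m)"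

definition nfa_header :: "nat \<Rightarrow> nat \<Rightarrow> nat \<Rightarrow> nat list" where
  "nfa_header \<kappa> n m =
     [(2 * \<kappa> + 1) * n, 2, num_states n, 4 * n + n * (2 * n + 2) + 3 * m, 0, 4 * n]"

definition input_list :: "nat \<Rightarrow> nat \<Rightarrow> (nat \<times> nat) list \<Rightarrow> nat list" where
  "input_list \<kappa> n es =
     nfa_header \<kappa> n (length es) @ padded \<kappa> n @ trans_code n (trans_list n es)"

text \<open>
  Registers: 0 is the output pointer, 1 to 5 and 7 to 14 hold the constants listed in
  \<open>const_regs\<close> below, 6 points behind the unread part of the edge list, 15 to 25 are scratch.
  The given matching program uses the registers from 30 on. Since edges are read backwards and
  each edge of two cells yields nine cells of output, no edge is overwritten before it is read.
  Minimum and maximum of \<open>u\<close> and \<open>v\<close> are computed as \<open>u - (u - v)\<close> and \<open>v + (u - v)\<close>.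
\<close>

definition edges_code :: code where
  "edges_code = whilec 2 6 (ops_code
    [OBin Minus 6 6 1, OGet 16 6, OBin Minus 6 6 1, OGet 15 6,
     OBin Minus 17 15 16, OBin Minus 18 15 17, OBin Plus 19 16 17,
     OBin Times 20 18 7, OBin Plus 20 20 10,
     OBin Plus 21 8 18, OBin Plus 22 8 19, OBin Plus 23 9 19, OBin Plus 24 20 1,
     OPush 24, OPush 3, OPush 23, OPush 23, OPush 3, OPush 21, OPush 22, OPush 3, OPush 20])"

text \<open>Register 25 counts the vertices down. Register 15 starts one behind the last state of
  the line and ends at its first state, which is one behind the line of the preceding vertex. The
  decrement between the two runs skips the gap in the line.\<close>

definition line_code :: code where
  "line_code =
     ops_code [OBin Minus 25 25 1, OBin Minus 15 15 1, OBin Minus 16 15 4] ;;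
     run_code 1 ;;
     ops_code [OBin Minus 15 15 1, OBin Minus 16 15 4] ;;
     run_code 1 ;;
     ops_code
      [OBin Minus 17 4 25, OBin Plus 18 15 17, OBin Plus 19 17 17, OBin Plus 20 18 4,
       OBin Plus 20 20 1, OBin Plus 21 4 4, OBin Plus 21 21 19,
       OPush 21, OPush 3, OPush 20, OPush 18, OPush 3, OPush 19]"

text \<open>The edge transitions stand last in \<open>trans_list\<close> so that they are written
  first: no later part reads the graph, which may then be overwritten.\<close>

definition generator_code :: code where
  "generator_code =
     edges_code ;;
     ops_code [OBin Plus 25 4 3, OBin Plus 15 13 3] ;;
     whilec 3 25 line_code ;;
     ops_code [OSet 16 0, OBin Minus 15 8 1] ;;
     run_code 2 ;;
     ops_code [OBin Plus 15 14 3] ;; rep_code 2 ;;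
     ops_code [OBin Plus 15 4 3] ;; rep_code 1 ;;
     ops_code [OBin Plus 15 14 3] ;; rep_code 2 ;;
     ops_code [OBin Minus 15 8 1, OPush 15, OPush 3, OPush 11, OPush 13, OPush 2, OPush 12]"

locale reduction =
  fixes n \<kappa> B :: nat and es :: "(nat \<times> nat) list" and M0 :: "nat \<Rightarrow> nat"
  assumes n: "n > 0"
    and es: "set es \<subseteq> {..<n} \<times> {..<n}"
    and M0: "\<And>i. i < length es \<Longrightarrow> M0 (2 + 2 * i) = fst (es ! i) \<and> M0 (3 + 2 * i) = snd (es ! i)"
    and B: "input_len \<kappa> n (length es) \<le> B" "\<kappa> \<le> B"
begin

abbreviation "m \<equiv> length es"
abbreviation "len \<equiv> input_len \<kappa> n m"

definition const_regs :: "(nat \<Rightarrow> nat) \<Rightarrow> bool" where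
  "const_regs R \<longleftrightarrow> R 1 = 1 \<and> R 2 = 2 \<and> R 3 = 0 \<and> R 4 = n \<and> R 5 = 3 * n \<and> R 7 = 2 * n + 2 \<and>
     R 8 = 4 * n + 1 \<and> R 9 = 5 * n + 1 \<and> R 10 = 7 * n + 1 \<and>
     R 11 = 4 * n + n * (2 * n + 2) + 3 * m \<and> R 12 = (2 * \<kappa> + 1) * n \<and> R 13 = num_states n \<and>
     R 14 = \<kappa> * n \<and> (\<forall>r \<ge> 30. R r = 0)"

lemma const_regs_upd [simp]:
  assumes "d = 0 \<or> d = 6 \<or> 15 \<le> d \<and> d < 30"
  shows "const_regs (R(d := x)) = const_regs R"
proof -
  have "(R(d := x)) r = R r" if "1 \<le> r \<and> r \<le> 5 \<or> 7 \<le> r \<and> r \<le> 14 \<or> 30 \<le> r" for r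
    using assms that by auto
  then show ?thesis
    unfolding const_regs_def by (simp del: fun_upd_apply)
qed

lemma const_regsD:
  assumes "const_regs R"
  shows "R (Suc 0) = Suc 0" "R 2 = 2" "R 3 = 0" "R 4 = n" "R 5 = 3 * n" "R 7 = 2 * n + 2"
    "R 8 = 4 * n + 1" "R 9 = 5 * n + 1" "R 10 = 7 * n + 1"
    "R 11 = 4 * n + n * (2 * n + 2) + 3 * m" "R 12 = (2 * \<kappa> + 1) * n" "R 13 = num_states n"
    "R 14 = \<kappa> * n"
  using assms unfolding const_regs_def by simp_all

lemma num_states_le: "num_states n \<le> B" "len \<le> B" "7 * n + 2 \<le> B"
  using B n mult_le_mono2[of 1 n n] by (auto simp: num_states_def input_len_def algebra_simps)

lemma triple_edges:
  "triple B (lift len M0 (\<lambda>R S. const_regs R \<and> R 6 = 2 + 2 * m \<and> S = [])) edges_code (m * 46 + 2)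
     (lift len M0 (\<lambda>R S. const_regs R \<and> S = trans_code n (concat (map (edge_trans n \<circ> up_edge) es))))"
proof -
  let ?I = "\<lambda>i R S. const_regs R \<and> R 6 = 2 + 2 * (m - i) \<and>
     S = trans_code n (concat (map (edge_trans n \<circ> up_edge) (drop (m - i) es)))"
  let ?ops = "[OBin Minus 6 6 1, OGet 16 6, OBin Minus 6 6 1, OGet 15 6,
     OBin Minus 17 15 16, OBin Minus 18 15 17, OBin Plus 19 16 17,
     OBin Times 20 18 7, OBin Plus 20 20 10,
     OBin Plus 21 8 18, OBin Plus 22 8 19, OBin Plus 23 9 19, OBin Plus 24 20 1,
     OPush 24, OPush 3, OPush 23, OPush 23, OPush 3, OPush 21, OPush 22, OPush 3, OPush 20]"
  have "triple B (lift len M0 (?I 0)) (whilec 2 6 (ops_code ?ops)) (m * (2 * length ?ops + 2) + 2)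
     (lift len M0 (?I m))"
  proof (rule triple_while_lift, rule triple_ops)
    fix i R S assume i: "i < m" and A: "?I i R S"
    define j where "j = m - Suc i"
    obtain u v where uv: "es ! j = (u, v)" by (cases "es ! j")
    have j: "j < m" "m - i = Suc j" using i by (auto simp: j_def)
    then have uv_less: "u < n" "v < n" using es nth_mem[of j es] uv by auto
    define d where "d = u - v"
    define a where "a = u - d"
    define b where "b = v + d"
    have ab: "up_edge (es ! j) = (a, b)" "a < n" "b < n"
      using uv uv_less by (auto simp: a_def b_def d_def)
    define r7 where "r7 = 2 * n + 2"
    define r8 where "r8 = 4 * n + 1"
    define r9 where "r9 = 5 * n + 1"
    define r10 where "r10 = 7 * n + 1"
    note r_defs = r7_def r8_def r9_def r10_def
    define e where "e = a * r7"
    define t where "t = e + r10"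
    define y where "y = r8 + a"
    define z where "z = r8 + b"
    define x where "x = r9 + b"
    \<comment> \<open>The offset \<open>7 * n + 1\<close> in register 10 is
      \<open>enc n (L 0 n)\<close>.\<close>
    have t: "t = enc n (L a n)" "Suc t = enc n (L a (n + 1))"
      by (simp_all add: t_def e_def r_defs)
    have tB: "Suc t \<le> B" using enc_less[of n "L a (n + 1)"] num_states_le(1) ab(2) unfolding t by simp
    have bnd: "t \<le> B" "e \<le> B" "a \<le> B" "b \<le> B" "d \<le> B" "x \<le> B" "y \<le> B" "z \<le> B"
      using num_states_le(3) uv_less ab(2,3) tB unfolding t_def x_def y_def z_def d_def r_defs by linarith+
    define p2 where "p2 = 2 + 2 * j"
    define p1 where "p1 = 3 + 2 * j"
    have R: "const_regs R" "R 6 = Suc p1" using A j by (auto simp: p1_def)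
    have "length S = 3 * length (concat (map (edge_trans n \<circ> up_edge) (drop (m - i) es)))"
      using A by (simp add: length_trans_code)
    also have "length (concat (map (edge_trans n \<circ> up_edge) xs)) = 3 * length xs" for xs
      by (induction xs) (auto simp: edge_trans_def split: prod.splits)
    finally have S: "length S = 9 * i" using i by simp
    \<comment> \<open>The second inequality says that the edge about to be read still lies below the
      output.\<close>
    have len: "length S + 9 \<le> len" "p1 + length S < len"
      using i unfolding S by (auto simp: j_def input_len_def p1_def)
    then have len': "length S < len" "length S + 1 < len" "length S + 2 < len" "length S + 3 < len"
      "length S + 4 < len" "length S + 5 < len" "length S + 6 < len" "length S + 7 < len"
      "length S + 8 < len" "p2 + length S < len" "p1 \<le> B" "p2 \<le> B"
      using num_states_le(2) by (auto simp: p1_def p2_def)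
    have M: "M0 p2 = u" "M0 p1 = v" using M0[OF j(1)] uv by (simp_all add: p1_def p2_def)
    have eqs: "p1 - Suc 0 = p2" "u - v = d" "u - d = a" "v + d = b" "a * r7 = e"
        "e + r10 = t" "r8 + a = y" "r8 + b = z" "r9 + b = x"
      by (simp_all add: a_def b_def d_def e_def t_def x_def y_def z_def p1_def p2_def)
    have out: "trans_code n (concat (map (edge_trans n \<circ> up_edge) (drop (m - Suc i) es))) =
       t # 0 # z # y # 0 # x # x # 0 # Suc t # S"
      using A j unfolding j_def[symmetric]
      by (simp add: trans_code_def edge_trans_def ab(1) t x_def y_def z_def r_defs
           flip: Cons_nth_drop_Suc[OF j(1)])
    have p2: "2 + 2 * (m - Suc i) = p2" by (simp add: p2_def j_def)
    show "owps len M0 B ?ops (?I (Suc i)) R S"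
      unfolding out p2 using len' len(2) R(1)
      by (simp add: M eqs bnd tB R(2) const_regsD(1-5)[OF R(1)]
        const_regsD(6-9)[OF R(1), folded r_defs])
  next
    fix i R S assume "i \<le> m" "?I i R S"
    then show "R 2 < R 6 \<longleftrightarrow> i < m" using const_regsD(2)[of R] by auto
  qed (use num_states_le in auto)
  then show ?thesis unfolding edges_code_def
    by (rule triple_weaken) (simp add: trans_code_def, simp, erule lift_mono, simp)
qed

lemma trans_code_line:
  assumes "u < n" "s = enc n (L u 0)"
  shows "trans_code n (line_trans n u) =
    [2 * (n - u), 0, s + (n - u), s + (n - u) + n + 1, 0, 2 * n + 2 * (n - u)] @
    run_out 1 s n @ run_out 1 (s + n + 1) n"
proof -
  have r1: "trans_code n (map (\<lambda>k. (L u k, Some 1, L u (Suc k))) [0..<0 + n]) = run_out 1 s n"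
    using assms(2) by (intro run_out_trans_code) simp_all
  have r2: "trans_code n (map (\<lambda>k. (L u k, Some 1, L u (Suc k))) [n + 1..<n + 1 + n]) =
      run_out 1 (s + n + 1) n"
    using assms(2) by (intro run_out_trans_code) simp_all
  have eq: "n + 1 + n = 2 * n + 1" by simp
  have line: "trans_code n (line_trans n u) =
      trans_code n [(C (2 * (n - u)), None, L u (n - u)),
        (L u (2 * n + 1 - u), None, C (2 * n + 2 * (n - u)))] @
      run_out 1 s n @ run_out 1 (s + n + 1) n"
    unfolding line_trans_def trans_code_append r1[unfolded add_0] r2[unfolded eq] ..
  show ?thesis
    using assms unfolding line by (simp add: trans_code_def)
qed

lemma triple_line:
  assumes u: "u < n" and len: "length S0 + 3 * (2 * n + 2) \<le> len"
  shows "triple B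
    (lift len M0 (\<lambda>R S. const_regs R \<and> R 25 = Suc u \<and> R 15 = enc n (L u 0) + (2 * n + 2) \<and> S = S0))
    line_code (n * 20 + 40)
    (lift len M0 (\<lambda>R S. const_regs R \<and> R 25 = u \<and> R 15 = enc n (L u 0) \<and>
       S = trans_code n (line_trans n u) @ S0))"
proof -
  define s where "s = enc n (L u 0)"
  have sB: "s + (2 * n + 1) < B"
    using enc_less[of n "L u (2 * n + 1)"] u num_states_le(1) by (simp add: s_def)
  let ?S1 = "run_out 1 (s + n + 1) n @ S0"
  let ?S2 = "run_out 1 s n @ ?S1"
  let ?F = "\<lambda>R. const_regs R \<and> R 25 = u"
  let ?A = "\<lambda>s f S0 R S. ?F R \<and> R 15 = s \<and> R 16 = f \<and> S = S0"
  have 1: "triple B (lift len M0 (\<lambda>R S. const_regs R \<and> R 25 = Suc u \<and> R 15 = s + (2 * n + 2) \<and> S = S0))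
      (ops_code [OBin Minus 25 25 1, OBin Minus 15 15 1, OBin Minus 16 15 4]) 6
      (lift len M0 (?A (s + n + 1 + n) (s + n + 1) S0))"
    using num_states_le u sB
    by (intro triple_weaken[OF triple_ops[of _ len M0 B]]) (auto simp: const_regsD)
  have 2: "triple B (lift len M0 (?A (s + n + 1 + n) (s + n + 1) S0)) (run_code 1) (n * 10 + 2)
      (lift len M0 (?A (s + n + 1) (s + n + 1) ?S1))"
    using triple_run[of ?F 1 1 S0 n len B "s + n + 1" M0] len sB num_states_le(2)
    by (simp add: const_regsD)
  have 3: "triple B (lift len M0 (?A (s + n + 1) (s + n + 1) ?S1))
      (ops_code [OBin Minus 15 15 1, OBin Minus 16 15 4]) 4
      (lift len M0 (?A (s + n) s ?S1))"
    using num_states_le u sB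
    by (intro triple_weaken[OF triple_ops[of _ len M0 B]]) (auto simp: const_regsD)
  have 4: "triple B (lift len M0 (?A (s + n) s ?S1)) (run_code 1) (n * 10 + 2)
      (lift len M0 (?A s s ?S2))"
    using triple_run[of ?F 1 1 ?S1 n len B s M0] len sB num_states_le(2)
    by (simp add: const_regsD length_run_out)
  let ?ops = "[OBin Minus 17 4 25, OBin Plus 18 15 17, OBin Plus 19 17 17, OBin Plus 20 18 4,
       OBin Plus 20 20 1, OBin Plus 21 4 4, OBin Plus 21 21 19,
       OPush 21, OPush 3, OPush 20, OPush 18, OPush 3, OPush 19]"
  have 5: "triple B (lift len M0 (?A s s ?S2)) (ops_code ?ops) 26
      (lift len M0 (\<lambda>R S. const_regs R \<and> R 25 = u \<and> R 15 = s \<and>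
         S = trans_code n (line_trans n u) @ S0))"
  proof (rule triple_weaken[OF triple_ops[of "?A s s ?S2" len M0 B]])
    fix R S assume A: "?A s s ?S2 R S"
    define j where "j = n - u"
    have eqs: "n - u = j" "j \<le> n" "s + j \<le> B" "Suc (s + j + n) \<le> B" "s + j + n \<le> B"
      "2 * n + 2 * j \<le> B" "n \<le> B" "2 * n \<le> B" "2 * j \<le> B" "j \<le> B"
      using sB num_states_le(3) by (auto simp: j_def)
    have len': "length S + 6 \<le> len" using A len by (auto simp: length_run_out)
    have out: "trans_code n (line_trans n u) @ S0 =
      (2 * j) # 0 # (s + j) # Suc (s + j + n) # 0 # (2 * n + 2 * j) # S"
      using A trans_code_line[OF u s_def] by (simp add: j_def)
    show "owps len M0 B ?ops (\<lambda>R S. const_regs R \<and> R 25 = u \<and> R 15 = s \<and>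
         S = trans_code n (line_trans n u) @ S0) R S"
      using A eqs(2-) len' unfolding out by (simp add: const_regsD eqs(1) mult_2)
  qed (use num_states_le in auto)
  show ?thesis
    unfolding line_code_def s_def[symmetric]
    by (rule triple_weaken[OF triple_seq[OF 1 triple_seq[OF 2 triple_seq[OF 3 triple_seq[OF 4 5]]]]])
      auto
qed

text \<open>Only the lines contribute a term quadratic in \<open>n\<close>; this is what density has
  to absorb.\<close>

definition gen_time :: nat where
  "gen_time = (m * 46 + 2) + (4 + ((n * (n * 20 + 40 + 2) + 2) + (4 + ((4 * n * 10 + 2) +
     (2 + ((\<kappa> * n * 6 + 2) + (2 + ((n * 6 + 2) + (2 + ((\<kappa> * n * 6 + 2) + 14))))))))))"

lemma triple_generator:
  "triple B (lift len M0 (\<lambda>R S. const_regs R \<and> R 6 = 2 + 2 * m \<and> S = [])) generator_code gen_time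
     (lift len M0 (\<lambda>R S. const_regs R \<and> S = input_list \<kappa> n es))"
proof -
  let ?lift = "lift len M0"
  let ?E = "trans_code n (concat (map (edge_trans n \<circ> up_edge) es))"
  let ?lines = "\<lambda>j. trans_code n (concat (map (line_trans n) [j..<n]))"
  have len_E: "length ?E = 9 * m"
    unfolding length_trans_code
    by (induction es) (auto simp: edge_trans_def split: prod.splits)
  have len_lines: "length (?lines j) = 3 * ((n - j) * (2 * n + 2))" for j
  proof -
    have "length (line_trans n u) = 2 * n + 2" for u by (simp add: line_trans_def)
    then show ?thesis
      unfolding length_trans_code
      by (simp add: length_concat comp_def sum_list_triv del: mult_Suc_right add_2_eq_Suc')
  qed
  have len_le: "6 + (2 * \<kappa> + 1) * n + 3 * (4 * n) + 3 * (n * (2 * n + 2)) + 9 * m = len"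
    by (simp add: input_len_def)
  let ?I = "\<lambda>i R S. const_regs R \<and> R 25 = n - i \<and> R 15 = 6 * n + 1 + (n - i) * (2 * n + 2) \<and>
     S = ?lines (n - i) @ ?E"
  have init: "triple B (?lift (\<lambda>R S. const_regs R \<and> S = ?E))
      (ops_code [OBin Plus 25 4 3, OBin Plus 15 13 3]) 4 (?lift (?I 0))"
    using num_states_le
    by (intro triple_weaken[OF triple_ops[of _ len M0 B]])
      (auto simp: const_regsD num_states_def trans_code_def)
  have lines: "triple B (?lift (?I 0)) (whilec 3 25 line_code) (n * (n * 20 + 40 + 2) + 2) (?lift (?I n))"
  proof (rule triple_while_lift)
    fix i assume i: "i < n"
    define u where "u = n - Suc i"
    then have u: "u < n" "n - i = Suc u" using i by auto
    have "(i + 1) * (2 * n + 2) \<le> n * (2 * n + 2)" using i by (intro mult_right_mono) auto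
    then have "length (?lines (Suc u) @ ?E) + 3 * (2 * n + 2) \<le> len"
      using len_le i u unfolding length_append len_lines len_E by (simp add: u_def)
    from triple_line[OF u(1) this]
    show "triple B (?lift (?I i)) line_code (n * 20 + 40) (?lift (?I (Suc i)))"
    proof (rule triple_weaken)
      fix R M assume "?lift (?I i) R M"
      then show "?lift (\<lambda>R S. const_regs R \<and> R 25 = Suc u \<and> R 15 = enc n (L u 0) + (2 * n + 2) \<and>
          S = ?lines (Suc u) @ ?E) R M"
        by (rule lift_mono) (simp add: u(2))
    next
      fix R M assume "?lift (\<lambda>R S. const_regs R \<and> R 25 = u \<and> R 15 = enc n (L u 0) \<and>
       S = trans_code n (line_trans n u) @ ?lines (Suc u) @ ?E) R M"
      then show "?lift (?I (Suc i)) R M"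
        using u(1) by (elim lift_mono) (simp add: upt_conv_Cons flip: u_def)
    qed simp
  next
    fix i R S assume "i \<le> n" "?I i R S"
    then show "R 3 < R 25 \<longleftrightarrow> i < n" using const_regsD(3)[of R] by auto
  qed simp_all
  let ?S1 = "?lines 0 @ ?E"
  have chain_init: "triple B (?lift (?I n)) (ops_code [OSet 16 0, OBin Minus 15 8 1]) 4
      (?lift (\<lambda>R S. const_regs R \<and> R 15 = 0 + 4 * n \<and> R 16 = 0 \<and> S = ?S1))"
    using num_states_le
    by (intro triple_weaken[OF triple_ops[of _ len M0 B]]) (auto simp: const_regsD)
  let ?S2 = "trans_code n (trans_list n es)"
  have S2: "?S2 = run_out 2 0 (4 * n) @ ?S1"
    using run_out_trans_code[of "4 * n" n C 0 0 2]
    by (simp add: trans_list_def chain_trans_def)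
  have chain: "triple B (?lift (\<lambda>R S. const_regs R \<and> R 15 = 0 + 4 * n \<and> R 16 = 0 \<and> S = ?S1)) (run_code 2)
      (4 * n * 10 + 2) (?lift (\<lambda>R S. const_regs R \<and> R 15 = 0 \<and> R 16 = 0 \<and> S = ?S2))"
    unfolding S2 using len_le num_states_le
    by (intro triple_run[of const_regs 2 2 ?S1 "4 * n" len B 0 M0])
      (auto simp: const_regsD len_lines len_E)
  have len_S2: "length ?S2 = 3 * (4 * n) + 3 * (n * (2 * n + 2)) + 9 * m"
    unfolding S2 by (simp add: length_run_out len_lines len_E)
  have \<kappa>: "\<kappa> * n \<le> B" using len_le num_states_le(2) by (simp add: algebra_simps)
  let ?S3 = "replicate (\<kappa> * n) 2 @ ?S2"
  let ?S4 = "replicate n 1 @ ?S3"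
  let ?S5 = "replicate (\<kappa> * n) 2 @ ?S4"
  have rep: "triple B (?lift (\<lambda>R S. const_regs R \<and> R 15 = k \<and> S = S0)) (rep_code l) (k * 6 + 2)
      (?lift (\<lambda>R S. const_regs R \<and> S = replicate k x @ S0))"
    if "l = 1 \<and> x = 1 \<or> l = 2 \<and> x = 2" "length S0 + k \<le> len" for k l x S0
    using that num_states_le by (intro triple_rep) (auto simp: const_regsD)
  have w1: "triple B (?lift (\<lambda>R S. const_regs R \<and> R 15 = 0 \<and> R 16 = 0 \<and> S = ?S2))
      (ops_code [OBin Plus 15 14 3]) 2 (?lift (\<lambda>R S. const_regs R \<and> R 15 = \<kappa> * n \<and> S = ?S2))"
    using num_states_le \<kappa> by (intro triple_weaken[OF triple_ops[of _ len M0 B]]) (auto simp: const_regsD)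
  have w2: "triple B (?lift (\<lambda>R S. const_regs R \<and> S = ?S3))
      (ops_code [OBin Plus 15 4 3]) 2 (?lift (\<lambda>R S. const_regs R \<and> R 15 = n \<and> S = ?S3))"
    using num_states_le by (intro triple_weaken[OF triple_ops[of _ len M0 B]]) (auto simp: const_regsD)
  have w3: "triple B (?lift (\<lambda>R S. const_regs R \<and> S = ?S4))
      (ops_code [OBin Plus 15 14 3]) 2 (?lift (\<lambda>R S. const_regs R \<and> R 15 = \<kappa> * n \<and> S = ?S4))"
    using num_states_le \<kappa> by (intro triple_weaken[OF triple_ops[of _ len M0 B]]) (auto simp: const_regsD)
  let ?ops = "[OBin Minus 15 8 1, OPush 15, OPush 3, OPush 11, OPush 13, OPush 2, OPush 12]"
  have header: "triple B (?lift (\<lambda>R S. const_regs R \<and> S = ?S5)) (ops_code ?ops) 14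
      (?lift (\<lambda>R S. const_regs R \<and> S = input_list \<kappa> n es))"
  proof (rule triple_weaken[OF triple_ops[of _ len M0 B]])
    fix R S assume A: "const_regs R \<and> S = ?S5"
    then have len_S: "length S + 6 \<le> len" using len_S2 len_le by simp
    have out: "input_list \<kappa> n es =
        ((2 * \<kappa> + 1) * n) # 2 # num_states n # (4 * n + n * (2 * n + 2) + 3 * m) # 0 # (4 * n) # S"
      using A by (simp add: input_list_def nfa_header_def padded_def)
    show "owps len M0 B ?ops (\<lambda>R S. const_regs R \<and> S = input_list \<kappa> n es) R S"
      using A len_S num_states_le(3) unfolding out by (simp add: const_regsD)
  qed (use num_states_le in auto)
  have lens: "length ?S2 + \<kappa> * n \<le> len" "length ?S3 + n \<le> len" "length ?S4 + \<kappa> * n \<le> len"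
    using len_S2 len_le by simp_all
  note r1 = rep[of 2 2 ?S2 "\<kappa> * n", OF _ lens(1)]
  note r2 = rep[of 1 1 ?S3 n, OF _ lens(2)]
  note r3 = rep[of 2 2 ?S4 "\<kappa> * n", OF _ lens(3)]
  show ?thesis
    unfolding generator_code_def gen_time_def
    using triple_seq[OF triple_edges triple_seq[OF init triple_seq[OF lines triple_seq[OF chain_init
      triple_seq[OF chain triple_seq[OF w1 triple_seq[OF r1 triple_seq[OF w2 triple_seq[OF r2
      triple_seq[OF w3 triple_seq[OF r3 header]]]]]]]]]]]
    by (simp add: add.assoc)
qed

end

section \<open>Deciding triangles\<close>

text \<open>Register 4 already holds \<open>n\<close>. Registers 8, 9, 10 hold \<open>4 * n\<close>,
  \<open>5 * n\<close>, \<open>7 * n\<close> until register 11 has been formed from the first, and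
  are then incremented. Register 6 is the number of edges until the end, when it becomes the address
  behind the last edge.\<close>

definition prelude_code :: "nat \<Rightarrow> code" where
  "prelude_code \<kappa> = (\<lambda>_.
     [Const 1 1, Const 2 2, Load 6 1,
      Binop Plus 15 4 4, Binop Plus 5 15 4, Binop Plus 7 15 2, Binop Plus 8 15 15,
      Binop Plus 9 8 4, Binop Plus 10 9 15,
      Binop Times 16 4 7, Binop Plus 11 8 16,
      Binop Plus 11 11 6, Binop Plus 11 11 6, Binop Plus 11 11 6,
      Binop Plus 8 8 1, Binop Plus 9 9 1, Binop Plus 10 10 1,
      Binop Minus 13 10 4, Binop Plus 13 13 16,
      Const 17 \<kappa>, Binop Times 14 17 4, Binop Plus 12 14 14, Binop Plus 12 12 4,
      Const 0 6, Binop Plus 0 0 12, Binop Plus 0 0 11, Binop Plus 0 0 11, Binop Plus 0 0 11,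
      Binop Plus 6 6 6, Binop Plus 6 6 2])"

text \<open>For natural numbers, \<open>(1 - (x - y)) * (1 - (y - x))\<close> is 1 if \<open>x = y\<close> and 0 otherwise.\<close>

definition decision_code :: code where
  "decision_code = (\<lambda>_.
     [Load 15 3, Load 16 1,
      Binop Minus 17 15 1, Binop Minus 17 1 17,
      Binop Minus 18 1 15, Binop Minus 18 1 18, Binop Times 17 17 18,
      Binop Minus 18 16 5, Binop Minus 18 1 18, Binop Times 17 17 18,
      Binop Minus 18 5 16, Binop Minus 18 1 18, Binop Times 17 17 18,
      Store 3 17])"

text \<open>For the empty graph, the answer 0 is already in place: the first input cell is \<open>n\<close>.\<close>

definition triangle_code :: "nat \<Rightarrow> prog \<Rightarrow> code" where
  "triangle_code \<kappa> P =
     (\<lambda>_. [Load 4 3]) ;;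
     unless_eqc 4 3 (prelude_code \<kappa> ;; generator_code ;; relocc 30 P ;; decision_code)"

lemma triple_decision:
  assumes "\<And>a. M1 a \<le> B" "3 * n \<le> B" "1 \<le> B"
  shows "triple B (\<lambda>R M. R 1 = 1 \<and> R 3 = 0 \<and> R 5 = 3 * n \<and> M = M1) decision_code 14
    (\<lambda>R M. M 0 = (if M1 0 = 1 \<and> M1 1 = 3 * n then 1 else 0))"
proof -
  show ?thesis
    unfolding decision_code_def
  proof (rule triple_wps)
    fix R M :: "nat \<Rightarrow> nat"
    assume A: "R 1 = 1 \<and> R 3 = 0 \<and> R 5 = 3 * n \<and> M = M1"
    define x where "x = M1 0"
    define y where "y = M1 (Suc 0)"
    define z where "z = 3 * n"
    define f1 where "f1 = Suc 0 - (x - Suc 0)"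
    define f2 where "f2 = Suc 0 - (Suc 0 - x)"
    define f3 where "f3 = Suc 0 - (y - z)"
    define f4 where "f4 = Suc 0 - (z - y)"
    \<comment> \<open>The bound applies to each product as soon as it is formed, so all partial
      products are shown to be at most 1.\<close>
    have f: "f1 \<le> 1" "f2 \<le> 1" "f3 \<le> 1" "f4 \<le> 1" by (auto simp: f1_def f2_def f3_def f4_def)
    then have "f1 * f2 \<le> 1 * 1" by (intro mult_le_mono) auto
    with f have "f1 * f2 * f3 \<le> 1 * 1" by (intro mult_le_mono) auto
    with f have "f1 * f2 * f3 * f4 \<le> 1 * 1" by (intro mult_le_mono) auto
    have fB: "f1 \<le> B" "f2 \<le> B" "f3 \<le> B" "f4 \<le> B" "f1 * f2 \<le> B" "f1 * f2 * f3 \<le> B"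
      "f1 * f2 * f3 * f4 \<le> B"
      using f \<open>f1 * f2 \<le> 1 * 1\<close> \<open>f1 * f2 * f3 \<le> 1 * 1\<close> \<open>f1 * f2 * f3 * f4 \<le> 1 * 1\<close> assms(3)
      by linarith+
    have sB: "x - Suc 0 \<le> B" "Suc 0 - x \<le> B" "y - z \<le> B" "z - y \<le> B"
      using assms(1)[of 0] assms(1)[of 1] assms(2,3) by (auto simp: x_def y_def z_def)
    have R: "R (Suc 0) = Suc 0" "R 3 = 0" "R 5 = z" "M 0 = x" "M (Suc 0) = y"
      using A by (auto simp: x_def y_def z_def)
    have res: "(if M1 0 = 1 \<and> M1 1 = 3 * n then 1 else 0) = f1 * f2 * f3 * f4"
      by (auto simp: f1_def f2_def f3_def f4_def x_def y_def z_def)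
    note folds = f1_def[symmetric] f2_def[symmetric] f3_def[symmetric] f4_def[symmetric]
    show "wps B [Load 15 3, Load 16 1,
      Binop Minus 17 15 1, Binop Minus 17 1 17,
      Binop Minus 18 1 15, Binop Minus 18 1 18, Binop Times 17 17 18,
      Binop Minus 18 16 5, Binop Minus 18 1 18, Binop Times 17 17 18,
      Binop Minus 18 5 16, Binop Minus 18 1 18, Binop Times 17 17 18,
      Store 3 17] (\<lambda>R M. M 0 = (if M1 0 = 1 \<and> M1 1 = 3 * n then 1 else 0)) R M"
      unfolding res by (simp add: R folds fB sB)
  qed simp
qed

context reduction
begin

text \<open>With empty output, \<open>lift\<close> demands the value 0 in every cell from
  \<open>len\<close> on, by the default of \<open>nth_default\<close>. The graph ends before
  \<open>len\<close>, so the second assumption supplies this.\<close>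

lemma triple_prelude:
  assumes "M0 1 = m" "\<And>a. 2 + 2 * m \<le> a \<Longrightarrow> M0 a = 0"
  shows "triple B (\<lambda>R M. R 4 = n \<and> (\<forall>r. r \<noteq> 4 \<longrightarrow> R r = 0) \<and> M = M0) (prelude_code \<kappa>) 30
    (lift len M0 (\<lambda>R S. const_regs R \<and> R 6 = 2 + 2 * m \<and> S = []))"
  unfolding prelude_code_def
proof (rule triple_wps)
  fix R M :: "nat \<Rightarrow> nat"
  assume A: "R 4 = n \<and> (\<forall>r. r \<noteq> 4 \<longrightarrow> R r = 0) \<and> M = M0"
  have lift: "lift l M0 (\<lambda>R S. const_regs R \<and> R 6 = p \<and> S = []) R M0"
    if "l = len" "R 0 = len" "const_regs R" "R 6 = p" for R l p
    using that assms(2) by (auto simp: lift_def input_len_def fun_eq_iff)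
  have R: "R 4 = n" "\<And>r. r \<noteq> 4 \<Longrightarrow> R r = 0" "M = M0" using A by simp_all
  have "len \<le> B" "\<kappa> \<le> B" using B by simp_all
  then show "wps B
     [Const 1 1, Const 2 2, Load 6 1,
      Binop Plus 15 4 4, Binop Plus 5 15 4, Binop Plus 7 15 2, Binop Plus 8 15 15,
      Binop Plus 9 8 4, Binop Plus 10 9 15,
      Binop Times 16 4 7, Binop Plus 11 8 16,
      Binop Plus 11 11 6, Binop Plus 11 11 6, Binop Plus 11 11 6,
      Binop Plus 8 8 1, Binop Plus 9 9 1, Binop Plus 10 10 1,
      Binop Minus 13 10 4, Binop Plus 13 13 16,
      Const 17 \<kappa>, Binop Times 14 17 4, Binop Plus 12 14 14, Binop Plus 12 12 4,
      Const 0 6, Binop Plus 0 0 12, Binop Plus 0 0 11, Binop Plus 0 0 11, Binop Plus 0 0 11,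
      Binop Plus 6 6 6, Binop Plus 6 6 2]
     (lift len M0 (\<lambda>R S. const_regs R \<and> R 6 = 2 + 2 * m \<and> S = [])) R M"
    using n
    by (simp add: R assms(1)[unfolded One_nat_def] input_len_def algebra_simps)
      (intro conjI lift; simp add: R const_regs_def num_states_def input_len_def algebra_simps)
qed simp

lemma triple_reduction:
  assumes "M0 1 = m" "\<And>a. 2 + 2 * m \<le> a \<Longrightarrow> M0 a = 0"
    and "halted P (config_at P (input_list \<kappa> n es) t)"
    and "\<And>s. s \<le> t \<Longrightarrow> values_bounded B (config_at P (input_list \<kappa> n es) s)"
  shows "triple B (\<lambda>R M. R 4 = n \<and> (\<forall>r. r \<noteq> 4 \<longrightarrow> R r = 0) \<and> M = M0)
    (prelude_code \<kappa> ;; generator_code ;; relocc 30 P ;; decision_code)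
    (30 + (gen_time + (t + 14)))
    (\<lambda>R M. M 0 = (if mem (config_at P (input_list \<kappa> n es) t) 0 = 1 \<and>
        mem (config_at P (input_list \<kappa> n es) t) 1 = 3 * n then 1 else 0))"
proof -
  let ?ws = "input_list \<kappa> n es"
  let ?M1 = "mem (config_at P ?ws t)"
  let ?init = "\<lambda>R M. (\<forall>r \<ge> 30. R r = 0) \<and> const_regs R \<and> M = mem (initial_config ?ws)"
  let ?done = "\<lambda>R M. R 1 = 1 \<and> R 3 = 0 \<and> R 5 = 3 * n \<and> M = ?M1"
  have len: "length ?ws = len"
    by (simp add: input_list_def nfa_header_def padded_def length_trans_code length_trans_list input_len_def)
  \<comment> \<open>\<open>triple_reloc\<close> fixes the contents of the protected registers,
    whereas \<open>const_regs\<close> leaves some open; the rule is therefore applied to the actual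
    contents \<open>R\<close>.\<close>
  have mid: "triple B ?init (relocc 30 P) t ?done"
  proof (rule tripleI)
    fix Q off R M
    assume A: "code_at Q off (relocc 30 P off)" "?init R M" "values_bounded B (cfg off R M)"
    have tr: "triple B (\<lambda>R' M. (\<forall>r \<ge> 30. R' r = 0) \<and> (\<forall>r < 30. R' r = R r) \<and> M = mem (initial_config ?ws))
       (relocc 30 P) t (\<lambda>R' M. (\<forall>r < 30. R' r = R r) \<and> M = ?M1)"
      using assms(3,4) by (rule triple_reloc)
    have pre: "(\<forall>r \<ge> 30. R r = 0) \<and> (\<forall>r < 30. R r = R r) \<and> M = mem (initial_config ?ws)"
      using A(2) by simp
    obtain t' R' M' where
      *: "t' \<le> t" "runs Q B (cfg off R M) t' (cfg (off + length (relocc 30 P off)) R' M')"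
      "(\<forall>r < 30. R' r = R r) \<and> M' = ?M1"
      "values_bounded B (cfg (off + length (relocc 30 P off)) R' M')"
      using tripleE[OF tr A(1) pre A(3)] .
    have "?done R' M'" using *(3) A(2) by (simp add: const_regs_def)
    then show "\<exists>t' \<le> t. \<exists>R' M'. runs Q B (cfg off R M) t' (cfg (off + length (relocc 30 P off)) R' M') \<and>
        ?done R' M'"
      using *(1,2) by blast
  qed
  have gen: "triple B (lift len M0 (\<lambda>R S. const_regs R \<and> R 6 = 2 + 2 * m \<and> S = [])) generator_code gen_time ?init"
  proof (rule triple_weaken[OF triple_generator])
    fix R M assume "lift len M0 (\<lambda>R S. const_regs R \<and> S = ?ws) R M"
    \<comment> \<open>The output has length \<open>len\<close>, so register 0 has reached 0 and
      nothing of the graph is left: the memory is that of a fresh run on the instance.\<close>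
    then have "R 0 = 0" "const_regs R" "M = (\<lambda>a. nth_default 0 ?ws a)"
      using len by (auto simp: lift_def)
    then show "?init R M"
      by (auto simp: const_regs_def initial_config_def nth_default_def)
  qed simp_all
  have "?M1 a \<le> B" for a using assms(4)[of t] by (simp add: values_bounded_def)
  then have "triple B ?done decision_code 14
     (\<lambda>R M. M 0 = (if ?M1 0 = 1 \<and> ?M1 1 = 3 * n then 1 else 0))"
    using num_states_le(3) n by (intro triple_decision) auto
  from triple_seq[OF triple_prelude[OF assms(1,2)] triple_seq[OF gen triple_seq[OF mid this]]]
  show ?thesis .
qed

end

text \<open>For \<open>n = 0\<close> there would be no word and no transition, and two letters would
  violate the bound on the alphabet in \<open>matching_inputs\<close>; hence
  \<open>n > 0\<close>.\<close>

lemma input_list_code: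
  assumes n: "n > 0" and es: "set es \<subseteq> {..<n} \<times> {..<n}" and dist: "distinct (map up_edge es)"
  shows "(padded \<kappa> n, walk_nfa n es) \<in> matching_inputs"
    and "matching_input_code (padded \<kappa> n, walk_nfa n es) (input_list \<kappa> n es)"
    and "card (trans (walk_nfa n es)) = 4 * n + n * (2 * n + 2) + 3 * length es"
proof -
  let ?ts = "map (enc_trans n) (trans_list n es)"
  have valid: "valid n p \<and> valid n q" if "(p, x, q) \<in> set (trans_list n es)" for p x q
    using trans_list_valid[OF es that] .
  have "inj_on (enc_trans n) (set (trans_list n es))"
    by (rule inj_onI) (auto dest: valid intro: enc_inj)
  then have d: "distinct ?ts" using distinct_trans_list[OF dist] by (simp add: distinct_map)
  have ts: "set ?ts = trans (walk_nfa n es)" by (simp add: walk_nfa_def)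
  show card: "card (trans (walk_nfa n es)) = 4 * n + n * (2 * n + 2) + 3 * length es"
    using distinct_card[OF d] unfolding ts by (simp add: length_trans_list)
  have labels: "x \<in> {None, Some 1, Some 2}" if "(p, x, q) \<in> set (trans_list n es)" for p x q
    using that by (cases rule: trans_list_cases) auto
  have "(enc n p, x, enc n q) \<in> {..<num_states n} \<times> insert None (Some ` {1..2}) \<times> {..<num_states n}"
    if "(p, x, q) \<in> set (trans_list n es)" for p x q
    using labels[OF that] valid[OF that] enc_less by auto
  then have "enc_trans n ` set (trans_list n es) \<subseteq>
      {..<num_states n} \<times> insert None (Some ` {1..2}) \<times> {..<num_states n}" by auto
  moreover have "4 * n < num_states n" by (simp add: num_states_def)
  ultimately have "is_enfa (walk_nfa n es)" by (simp add: is_enfa_def walk_nfa_def)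
  moreover have "card (states (walk_nfa n es)) = num_states n" "card (alphabet (walk_nfa n es)) = 2"
    by (simp_all add: walk_nfa_def)
  ultimately show "(padded \<kappa> n, walk_nfa n es) \<in> matching_inputs"
    using n card by (auto simp: matching_inputs_def padded_def num_states_def walk_nfa_def)
  show "matching_input_code (padded \<kappa> n, walk_nfa n es) (input_list \<kappa> n es)"
    unfolding matching_input_code_def prod.case using d ts
  proof (intro exI[of _ ?ts] conjI)
    show "input_list \<kappa> n es = [length (padded \<kappa> n), card (alphabet (walk_nfa n es)),
        card (states (walk_nfa n es)), length ?ts, init (walk_nfa n es), final (walk_nfa n es)] @
        padded \<kappa> n @ concat (map (\<lambda>(p, x, q). [p, label_code x, q]) ?ts)"
      by (simp add: input_list_def nfa_header_def trans_code_def padded_def walk_nfa_def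
          length_trans_list comp_def split_def)
  qed
qed

section \<open>Input layout, time and word length\<close>

lemma nth_concat_pairs:
  assumes "i < length es"
  shows "concat (map (\<lambda>(u, v). [u, v]) es) ! (2 * i) = fst (es ! i)"
    "concat (map (\<lambda>(u, v). [u, v]) es) ! Suc (2 * i) = snd (es ! i)"
  using assms by (induction es arbitrary: i) (auto simp: nth_Cons' less_Suc_eq_0_disj split: prod.splits)

lemma length_concat_pairs: "length (concat (map (\<lambda>(u, v). [u, v]) es)) = 2 * length es"
  by (induction es) auto

text \<open>Every instance needs a bound, but \<open>O\<close> speaks of large \<open>N\<close>
  only: \<open>D\<close> adds up the finitely many exceptions, and \<open>N + 1\<close> makes room
  for \<open>N = 0\<close>.\<close>

lemma linear_bound:
  assumes "(\<lambda>N. real (T N)) \<in> O(\<lambda>N. real N)"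
  obtains D :: nat where "\<forall>N. T N \<le> D * (N + 1)"
proof -
  obtain c where "\<forall>\<^sub>F N in at_top. norm (real (T N)) \<le> c * norm (real N)"
    using assms by (elim landau_o.bigE)
  then obtain N0 where c: "\<And>N. N \<ge> N0 \<Longrightarrow> real (T N) \<le> c * real N"
    unfolding eventually_at_top_linorder by auto
  define D where "D = nat \<lceil>\<bar>c\<bar>\<rceil> + (\<Sum>i<N0. T i)"
  have "T N \<le> D * (N + 1)" for N
  proof (cases "N < N0")
    case True
    then have "T N \<le> (\<Sum>i<N0. T i)" by (intro member_le_sum) auto
    then have "T N \<le> D * 1" by (simp add: D_def)
    also have "\<dots> \<le> D * (N + 1)" by (intro mult_le_mono) auto
    finally show ?thesis .
  next
    case False
    have "c \<le> real D" unfolding D_def by linarith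
    then have "c * real N \<le> real D * real (N + 1)" by (intro mult_mono) auto
    moreover have "real (T N) \<le> c * real N" using c[of N] False by simp
    ultimately have "real (T N) \<le> real (D * (N + 1))" unfolding of_nat_mult by linarith
    then show ?thesis by linarith
  qed
  then show thesis using that by blast
qed

text \<open>One argument serves all four problems: string and length answers differ only behind the
  second cell, and the hypothesis on \<open>R\<close> concerns only the first two.\<close>

lemma dense_triangle_from_matching:
  fixes R :: "nat list \<Rightarrow> (nat, nat) enfa \<Rightarrow> 'r answer \<Rightarrow> bool"
  assumes sol: "solvable_in_time_O (matching_problem R answer_code) (\<lambda>N. real N)"
    and \<kappa>: "\<kappa> \<le> 2"
    and R: "\<And>n es ans. n > 0 \<Longrightarrow> set es \<subseteq> {..<n} \<times> {..<n} \<Longrightarrow> R (padded \<kappa> n) (walk_nfa n es) ans \<Longrightarrow>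
       (\<exists>l zs. answer_code ans = 1 # l # zs \<and> (l = 3 * n \<longleftrightarrow> (\<exists>u. walk (up_edge ` set es) u u))) \<or>
       (\<exists>z zs. answer_code ans = z # zs \<and> z \<noteq> 1 \<and> \<not> (\<exists>u. walk (up_edge ` set es) u u))"
    and c: "c > 0"
  shows "solvable_in_time_O (dense_triangle_problem c) (\<lambda>N. real N)"
proof -
  from sol obtain P T' where P: "solves_within P (matching_problem R answer_code) T'"
    and T': "(\<lambda>N. real (T' N)) \<in> O(\<lambda>N. real N)"
    unfolding solvable_in_time_O_def by blast
  from P obtain k where k: "\<And>x ws. x \<in> matching_inputs \<Longrightarrow> matching_input_code x ws \<Longrightarrow>
      \<exists>t \<le> T' (length (fst x) + card (trans (snd x))). \<exists>out ans.
        halted P (config_at P ws t) \<and> R (fst x) (snd x) ans \<and> out = answer_code ans \<and>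
        (\<forall>a < length out. mem (config_at P ws t) a = out ! a) \<and>
        (\<forall>s \<le> t. values_bounded ((length (fst x) + card (trans (snd x)) + 2) ^ k) (config_at P ws s))"
    unfolding solves_within_def matching_problem_def by (fastforce simp: split_def)
  obtain D where D: "\<forall>N. T' N \<le> D * (N + 1)" using linear_bound[OF T'] .
  define q where "q = nat \<lceil>1 / c\<rceil>"
  \<comment> \<open>Relative to \<open>n * n + N + 1\<close>, the 400 covers the generator and the
    fixed code, and the 20 the size of the generated instance; density trades this quantity for
    \<open>(q + 1) * (N + 1)\<close>.\<close>
  define F where "F = (400 + D * 20) * (q + 1)"
  define T where "T N = F * (N + 1)" for N
  have "(\<lambda>N. real (T N)) \<in> O(\<lambda>N. real N)"
  proof (rule landau_o.bigI[of "2 * (real F + 1)"])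
    show "\<forall>\<^sub>F N in at_top. norm (real (T N)) \<le> 2 * (real F + 1) * norm (real N)"
      using eventually_ge_at_top[of 1]
    proof eventually_elim
      case (elim N)
      then have "F * (N + 1) \<le> 2 * (F + 1) * N" by (cases N) (auto simp: algebra_simps)
      then have "real (F * (N + 1)) \<le> real (2 * (F + 1) * N)" by linarith
      then show ?case by (simp add: T_def algebra_simps)
    qed
  qed simp
  moreover have "solves_within (triangle_code \<kappa> P 0) (dense_triangle_problem c) T"
    unfolding solves_within_def
  proof (rule exI[of _ "8 * (k + 1)"], intro ballI allI impI)
    fix G ws assume G: "G \<in> instances (dense_triangle_problem c)"
      and ws: "input_code (dense_triangle_problem c) G ws"
    obtain n E where nE: "G = (n, E)" by (cases G)
    have graph: "is_graph (n, E)" and dense: "c * real n ^ 2 \<le> real (card E)"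
      using G by (auto simp: dense_triangle_problem_def nE)
    obtain es where es: "distinct (map (\<lambda>(u, v). {u, v}) es)" "set (map (\<lambda>(u, v). {u, v}) es) = E"
      "ws = [n, length es] @ concat (map (\<lambda>(u, v). [u, v]) es)"
      using ws by (auto simp: dense_triangle_problem_def edge_list_code_def nE)
    have size: "inst_size (dense_triangle_problem c) G = n + length es"
      using distinct_card[OF es(1)] es(2) by (simp add: dense_triangle_problem_def nE)
    have in_range: "set es \<subseteq> {..<n} \<times> {..<n}"
    proof
      fix e assume "e \<in> set es"
      then have "{fst e, snd e} \<in> E" using es(2) by force
      then show "e \<in> {..<n} \<times> {..<n}"
        using graph by (cases e) (fastforce simp: is_graph_def doubleton_eq_iff)
    qed
    have "inj_on up_edge (set es)"
    proof (rule inj_onI)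
      fix e f assume *: "e \<in> set es" "f \<in> set es" "up_edge e = up_edge f"
      then have eq: "(\<lambda>(u, v). {u, v}) e = (\<lambda>(u, v). {u, v}) f"
        by (cases e; cases f) (auto simp: min_def max_def split: if_splits)
      have "inj_on (\<lambda>(u, v). {u, v}) (set es)" using es(1) by (simp only: distinct_map)
      from inj_onD[OF this eq *(1,2)] show "e = f" .
    qed
    then have dist: "distinct (map up_edge es)" using es(1) by (simp add: distinct_map)
    define m where "m = length es"
    define N where "N = n + m"
    \<comment> \<open>The size of the generated instance plus 2 is at most
      \<open>(N + 2) ^ 8\<close>, so the numbers of the given program are at most
      \<open>(N + 2) ^ (8 * k)\<close>. The extra factor leaves room for the generator, also when
      \<open>k = 0\<close>.\<close>
    define B where "B = (N + 2) ^ (8 * (k + 1))"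
    define M0 where "M0 = mem (initial_config ws)"
    have M0: "M0 0 = n" "M0 1 = m" "\<And>a. 2 + 2 * m \<le> a \<Longrightarrow> M0 a = 0"
      by (auto simp: M0_def initial_config_def es(3) length_concat_pairs m_def)
    have M0_edges: "M0 (2 + 2 * i) = fst (es ! i) \<and> M0 (3 + 2 * i) = snd (es ! i)" if "i < m" for i
      using nth_concat_pairs[of i es] that
      by (simp add: M0_def initial_config_def es(3) length_concat_pairs m_def nth_append numeral_3_eq_3)
    have N2: "2 \<le> N + 2" by simp
    have len_le: "input_len \<kappa> n m \<le> (N + 2) ^ 8"
    proof -
      have "(2 * \<kappa> + 1) * n \<le> 5 * n" using \<kappa> by (intro mult_right_mono) auto
      then have "input_len \<kappa> n m \<le> 6 + 5 * n + 3 * (4 * n + n * (2 * n + 2) + 3 * m)"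
        unfolding input_len_def by linarith
      \<comment> \<open>64 is \<open>2 ^ 6\<close>, hence at most
        \<open>(N + 2) ^ 6\<close>.\<close>
      also have "\<dots> \<le> 64 * (N + 2) ^ 2"
        by (simp add: N_def power2_eq_square algebra_simps)
      also have "\<dots> \<le> (N + 2) ^ 6 * (N + 2) ^ 2"
        using power_mono[OF N2, of 6] by (intro mult_right_mono) auto
      finally show ?thesis by (simp flip: power_add)
    qed
    have "(N + 2) ^ 8 \<le> B" "N + 2 \<le> B"
      unfolding B_def using power_increasing[of 8 "8 * (k + 1)" "N + 2"]
        power_increasing[of 1 "8 * (k + 1)" "N + 2"] by simp_all
    then have len_B: "input_len \<kappa> n m \<le> B" "\<kappa> \<le> B" using len_le \<kappa> by linarith+
    have M0_le: "M0 a \<le> n + m" for a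
    proof -
      consider "a = 0" | "a = 1" | "2 + 2 * m \<le> a" | i where "i < m" "a = 2 + 2 * i"
        | i where "i < m" "a = 3 + 2 * i"
      proof (atomize_elim, cases "a < 2 \<or> 2 + 2 * m \<le> a")
        case False
        then have "(a - 2) div 2 < m" "a = 2 + 2 * ((a - 2) div 2) \<or> a = 3 + 2 * ((a - 2) div 2)" by presburger+
        then show "a = 0 \<or> a = 1 \<or> 2 + 2 * m \<le> a \<or> (\<exists>i<m. a = 2 + 2 * i) \<or> (\<exists>i<m. a = 3 + 2 * i)"
          by blast
      qed auto
      then show ?thesis
      proof cases
        case (4 i)
        then show ?thesis using M0_edges[of i] in_range nth_mem[of i es] by (fastforce simp: m_def)
      next
        case (5 i)
        then show ?thesis using M0_edges[of i] in_range nth_mem[of i es] by (fastforce simp: m_def)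
      next
        case 2
        then show ?thesis using M0(2) by simp
      qed (auto simp: M0)
    qed
    have "M0 a \<le> B" for a using M0_le[of a] \<open>N + 2 \<le> B\<close> unfolding N_def by linarith
    then have vb: "values_bounded B (cfg 0 (\<lambda>_. 0) M0)" by (simp add: values_bounded_def)
    let ?tri = "has_triangle (n, E)"
    let ?Post = "\<lambda>R M. M 0 = (if ?tri then 1 else 0 :: nat)"
    have "triple B (\<lambda>R M. (\<forall>r. R r = 0) \<and> M = M0) (triangle_code \<kappa> P) (T N) ?Post"
    proof (cases "n = 0")
      case True
      then have no_tri: "\<not> ?tri" by (auto simp: has_triangle_def)
      have "triple B (\<lambda>R M. (\<forall>r. R r = 0) \<and> M = M0) (\<lambda>_. [Load 4 3]) 1
          (\<lambda>R M. R 4 = R 3 \<and> M = M0)"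
        by (rule triple_wps) (auto simp: M0 True)
      \<comment> \<open>The guarded code is never entered here: its precondition is contradictory,
        so time 0 will do.\<close>
      moreover have "triple B (\<lambda>R M. R 4 = R 3 \<and> M = M0)
          (unless_eqc 4 3 (prelude_code \<kappa> ;; generator_code ;; relocc 30 P ;; decision_code)) (0 + 1) ?Post"
        using no_tri by (intro triple_unless_eq) (auto simp: M0 True triple_def)
      ultimately have "triple B (\<lambda>R M. (\<forall>r. R r = 0) \<and> M = M0) (triangle_code \<kappa> P) (1 + (0 + 1)) ?Post"
        unfolding triangle_code_def by (rule triple_seq)
      then show ?thesis
        by (rule triple_weaken) (auto simp: T_def F_def)
    next
      case False
      then have n: "n > 0" by simp
      interpret red: reduction n \<kappa> B es M0
        using n in_range M0_edges len_B by unfold_locales (auto simp: m_def)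
      let ?S = "length (padded \<kappa> n) + card (trans (walk_nfa n es))"
      note inst = input_list_code[OF n in_range dist]
      obtain t ans where t: "t \<le> T' ?S" and halt: "halted P (config_at P (input_list \<kappa> n es) t)"
        and ans: "R (padded \<kappa> n) (walk_nfa n es) ans"
        and out: "\<forall>a < length (answer_code ans).
          mem (config_at P (input_list \<kappa> n es) t) a = answer_code ans ! a"
        and bnd: "\<forall>s \<le> t. values_bounded ((?S + 2) ^ k) (config_at P (input_list \<kappa> n es) s)"
        using k[OF inst(1,2)[of \<kappa>]] by auto
      have S: "?S = (2 * \<kappa> + 1) * n + (4 * n + n * (2 * n + 2) + 3 * m)"
        by (simp add: inst(3) padded_def m_def)
      then have "?S + 2 \<le> (N + 2) ^ 8" using len_le by (simp add: input_len_def)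
      then have "(?S + 2) ^ k \<le> ((N + 2) ^ 8) ^ k" by (rule power_mono) simp
      also have "\<dots> \<le> B" unfolding B_def by (subst power_mult[symmetric]) (rule power_increasing; simp)
      finally have bnd': "values_bounded B (config_at P (input_list \<kappa> n es) s)" if "s \<le> t" for s
        using bnd that by (auto simp: values_bounded_def intro: order_trans)
      have tri: "?tri \<longleftrightarrow> (\<exists>u. walk (up_edge ` set es) u u)"
        using has_triangle_iff_walk[OF graph] es(2) by simp
      let ?M = "mem (config_at P (input_list \<kappa> n es) t)"
      have res: "?M 0 = 1 \<and> ?M 1 = 3 * n \<longleftrightarrow> ?tri"
        unfolding tri using R[OF n in_range ans]
      proof (elim disjE exE conjE)
        fix l zs assume *: "answer_code ans = 1 # l # zs"
          "(l = 3 * n) = (\<exists>u. walk (up_edge ` set es) u u)"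
        then have "?M 0 = 1" "?M 1 = l" using out by auto
        then show "?M 0 = 1 \<and> ?M 1 = 3 * n \<longleftrightarrow> (\<exists>u. walk (up_edge ` set es) u u)" using *(2) by simp
      next
        \<comment> \<open>Cell 1 need not belong to the answer now and may hold anything; the test
          of cell 0 already fails.\<close>
        fix z zs assume *: "answer_code ans = z # zs" "z \<noteq> 1" "\<not> (\<exists>u. walk (up_edge ` set es) u u)"
        then have "?M 0 = z" using out by auto
        then show "?M 0 = 1 \<and> ?M 1 = 3 * n \<longleftrightarrow> (\<exists>u. walk (up_edge ` set es) u u)" using *(2,3) by simp
      qed
      \<comment> \<open>The only use of density: the edges pay for the \<open>n\<close> lines of
        \<open>2 * n + 2\<close> states.\<close>
      have "n * n \<le> q * N"
      proof -
        have "real n ^ 2 \<le> 1 / c * real (card E)" using dense c by (simp add: field_simps)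
        also have "\<dots> \<le> real q * real N"
        proof (intro mult_mono)
          show "1 / c \<le> real q" unfolding q_def by (rule real_nat_ceiling_ge)
          show "real (card E) \<le> real N"
            using distinct_card[OF es(1)] unfolding es(2) N_def m_def by simp
        qed simp_all
        finally have "real (n * n) \<le> real (q * N)" by (simp add: power2_eq_square)
        then show ?thesis by linarith
      qed
      then have X: "n * n + N + 1 \<le> (q + 1) * (N + 1)" by (simp add: algebra_simps)
      define z where "z = \<kappa> * n"
      have z: "z \<le> 2 * n" using \<kappa> unfolding z_def by (rule mult_right_mono) simp
      have z2: "(2 * \<kappa> + 1) * n = 2 * z + n" by (simp add: z_def)
      have "?S + 1 \<le> 20 * (n * n + N + 1)"
        using z unfolding S z2 N_def by (simp add: algebra_simps)
      then have "T' ?S \<le> D * (20 * (n * n + N + 1))" using D mult_le_mono2 le_trans by blast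
      moreover have "red.gen_time + 60 \<le> 400 * (n * n + N + 1)"
        using z unfolding red.gen_time_def N_def m_def z_def[symmetric] by (simp add: algebra_simps)
      ultimately have "1 + (30 + (red.gen_time + (t + 14)) + 1) \<le> (400 + D * 20) * (n * n + N + 1)"
        using t by (simp add: algebra_simps)
      also have "\<dots> \<le> (400 + D * 20) * ((q + 1) * (N + 1))" using X by (rule mult_le_mono2)
      also have "\<dots> = T N" unfolding T_def F_def by (rule mult.assoc[symmetric])
      finally have time: "1 + (30 + (red.gen_time + (t + 14)) + 1) \<le> T N" .
      let ?Pre = "\<lambda>R M. R 4 = n \<and> (\<forall>r. r \<noteq> 4 \<longrightarrow> R r = 0) \<and> M = M0"
      have 1: "triple B (\<lambda>R M. (\<forall>r. R r = 0) \<and> M = M0) (\<lambda>_. [Load 4 3]) 1 ?Pre"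
        by (rule triple_wps) (auto simp: M0)
      have "triple B ?Pre (prelude_code \<kappa> ;; generator_code ;; relocc 30 P ;; decision_code)
          (30 + (red.gen_time + (t + 14))) ?Post"
        using red.triple_reduction[OF _ _ halt bnd'] M0 res by (simp add: m_def)
      then have "triple B ?Pre
          (unless_eqc 4 3 (prelude_code \<kappa> ;; generator_code ;; relocc 30 P ;; decision_code))
          (30 + (red.gen_time + (t + 14)) + 1) ?Post"
        using n by (intro triple_unless_eq) (auto elim: triple_weaken)
      from triple_weaken[OF triple_seq[OF 1 this] _ time] show ?thesis
        unfolding triangle_code_def by simp
    qed
    moreover have "code_at (triangle_code \<kappa> P 0) 0 (triangle_code \<kappa> P 0)" by (simp add: code_at_def)
    ultimately obtain t Rt Mt where run: "t \<le> T N"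
      "runs (triangle_code \<kappa> P 0) B (cfg 0 (\<lambda>_. 0) M0) t
         (cfg (0 + length (triangle_code \<kappa> P 0)) Rt Mt)" "?Post Rt Mt"
      by (rule tripleE[OF _ _ _ vb]) auto
    have "initial_config ws = cfg 0 (\<lambda>_. 0) M0" by (simp add: M0_def initial_config_def)
    then have "config_at (triangle_code \<kappa> P 0) ws t = cfg (length (triangle_code \<kappa> P 0)) Rt Mt"
      "\<forall>s \<le> t. values_bounded B (config_at (triangle_code \<kappa> P 0) ws s)"
      using run(2) by (simp_all add: runs_def config_at_def)
    then show "\<exists>t \<le> T (inst_size (dense_triangle_problem c) G). \<exists>out.
        halted (triangle_code \<kappa> P 0) (config_at (triangle_code \<kappa> P 0) ws t) \<and>
        output_code (dense_triangle_problem c) G out \<and>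
        (\<forall>a < length out. mem (config_at (triangle_code \<kappa> P 0) ws t) a = out ! a) \<and>
        (\<forall>s \<le> t. values_bounded ((inst_size (dense_triangle_problem c) G + 2) ^ (8 * (k + 1)))
           (config_at (triangle_code \<kappa> P 0) ws s))"
      using run(1,3) unfolding size
      by (intro exI[of _ t]) (simp add: halted_def dense_triangle_problem_def nE B_def N_def m_def)
  qed
  ultimately show ?thesis unfolding solvable_in_time_O_def by blast
qed

text \<open>The length precedes the string in the answer, so the decision never looks at the string
  itself.\<close>

lemma string_answer_code_cases:
  assumes "(\<exists>y. ans = Match y \<and> length y = k) \<longleftrightarrow> X"
  shows "(\<exists>l zs. string_answer_code ans = 1 # l # zs \<and> (l = k \<longleftrightarrow> X)) \<or>
    (\<exists>z zs. string_answer_code ans = z # zs \<and> z \<noteq> 1 \<and> \<not> X)"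
  using assms by (cases ans) auto

lemma length_answer_code_cases:
  assumes "length_only R w A l" "\<And>ans. R w A ans \<Longrightarrow> (\<exists>y. ans = Match y \<and> length y = k) \<longleftrightarrow> X"
  shows "(\<exists>l' zs. length_answer_code l = 1 # l' # zs \<and> (l' = k \<longleftrightarrow> X)) \<or>
    (\<exists>z zs. length_answer_code l = z # zs \<and> z \<noteq> 1 \<and> \<not> X)"
proof -
  obtain ans where "R w A ans" "l = map_answer length ans"
    using assms(1) by (auto simp: length_only_def)
  then show ?thesis using assms(2)[of ans] by (cases ans) auto
qed

theorem theorem7p4:
  assumes "solvable_in_time_O min_subseq_problem (\<lambda>N. real N) \<or>
           solvable_in_time_O max_superseq_problem (\<lambda>N. real N) \<or>
           solvable_in_time_O min_subseq_length_problem (\<lambda>N. real N) \<or>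
           solvable_in_time_O max_superseq_length_problem (\<lambda>N. real N)"
  shows "\<forall>c > 0. solvable_in_time_O (dense_triangle_problem c) (\<lambda>N. real N)"
proof (intro allI impI)
  fix c :: real assume c: "c > 0"
  from assms show "solvable_in_time_O (dense_triangle_problem c) (\<lambda>N. real N)"
    unfolding min_subseq_problem_def max_superseq_problem_def min_subseq_length_problem_def
      max_superseq_length_problem_def
  proof (elim disjE)
    assume "solvable_in_time_O (matching_problem min_subseq_answer string_answer_code) real"
    then show ?thesis
      by (rule dense_triangle_from_matching[of _ _ 2, OF _ _ _ c])
        (simp, rule string_answer_code_cases[OF min_subseq_iff])
  next
    assume "solvable_in_time_O (matching_problem max_superseq_answer string_answer_code) real"
    then show ?thesis
      by (rule dense_triangle_from_matching[of _ _ 0, OF _ _ _ c])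
        (simp, rule string_answer_code_cases[OF max_superseq_iff])
  next
    assume "solvable_in_time_O (matching_problem (length_only min_subseq_answer) length_answer_code) real"
    then show ?thesis
      by (rule dense_triangle_from_matching[of _ _ 2, OF _ _ _ c])
        (simp, rule length_answer_code_cases[OF _ min_subseq_iff])
  next
    assume "solvable_in_time_O (matching_problem (length_only max_superseq_answer) length_answer_code) real"
    then show ?thesis
      by (rule dense_triangle_from_matching[of _ _ 0, OF _ _ _ c])
        (simp, rule length_answer_code_cases[OF _ max_superseq_iff])
  qed
qed

end
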